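(* Let $(M,\mathbf g)$ be a smooth Riemannian manifold of dimension $n$. Let $W$ be a fiberwise spherically symmetric extended scalar field on $M$, i.e. $W=W(x^1,\dots,x^n,v)$ with $v=|\mathbf v|>0$, such that $W'=\partial W/\partial v\neq 0$, and consider the Newtonian dynamical system $\dot x^k=v^k$, $\nabla_t v^k=F^k$ on $M$ whose force field $\mathbf F$ has covariant components $$F_r=-|\mathbf v|\sum_{s=1}^n\frac{\nabla_sW}{W'}\cdot\left(\frac{2\,v^s v_r}{|\mathbf v|^2}-\delta^s_r\right),\qquad r=1,\dots,n.$$ Then this system possesses a Lagrangian structure with a fiberwise spherically symmetric regular Lagrange function $L=L(x^1,\dots,x^n,v)$ if and only if its force field is given by the formula $$F_r=-|\mathbf v|^2\,\nabla_r f+2\left(\sum_{s=1}^n \nabla_s f\; v^s\right) v_r,\qquad r=1,\dots,n,$$ for some smooth function $f=f(x^1,\dots,x^n)$ on $M$ (depending on the point of $M$ only). The latter force field is the special case of the former one obtained for $W=v\cdot e^{-f}$.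
   Context: Notation: $x^1,\dots,x^n$ are local coordinates on $M$; $v^1,\dots,v^n$ are the components of a tangent vector $\mathbf v\in T_pM$; $v_r=\sum_s g_{rs}v^s$; $|\mathbf v|$ is the length of $\mathbf v$ in the metric $\mathbf g$; $\Gamma^k_{ij}$ are the Christoffel symbols of the Levi-Civita connection. All extended fields below are smooth and are considered at the points $(p,\mathbf v)\in TM$ with $\mathbf v\neq 0$. An extended vector (tensor, scalar) field on $M$ assigns to each such $(p,\mathbf v)$ a vector in $T_pM$ (respectively a tensor at $p$, a number); in coordinates its components are functions of $(x^1,\dots,x^n,v^1,\dots,v^n)$. Newtonian dynamical system with force field $\mathbf F$ (an extended vector field): the system $\dot x^k=v^k$, $\nabla_t v^k=F^k(x,\mathbf v)$, where $\nabla_tv^k=\dot v^k+\sum_{i,j}\Gamma^k_{ij}v^iv^j$. Covariant components of the force are $F_r=\sum_k g_{rk}F^k$. Covariant differentiations of extended fields. Velocity gradient: $\tilde\nabla_q X=\partial X/\partial v^q$ (componentwise, for a tensor field of any type). Spatial gradient: for an extended scalar field, $$\nabla_qX=\frac{\partial X}{\partial x^q}-\sum_{a,b}v^a\Gamma^b_{qa}\frac{\partial X}{\partial v^b},$$ and for an extended covector field $X_k$, $$\nabla_qX_k=\frac{\partial X_k}{\partial x^q}-\sum_{a,b}v^a\Gamma^b_{qa}\frac{\partial X_k}{\partial v^b}-\sum_b\Gamma^b_{qk}X_b .$$ Fiberwise spherically symmetric scalar field: an extended scalar field depending on $\mathbf v$ only through $v=|\mathbf v|$, written $X(x^1,\dots,x^n,v)$;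 a prime denotes the partial derivative with respect to $v$. For such a field $\nabla_sX$ equals the partial derivative of $X(x^1,\dots,x^n,v)$ with respect to $x^s$ at fixed $v$. Lagrangian structure: the Newtonian system with force field $\mathbf F$ possesses a Lagrangian structure with regular Lagrange function $L$ (an extended scalar field) if its equations are the Euler–Lagrange equations of $L$, that is, $\det(\tilde\nabla_i\tilde\nabla_jL)\neq0$ (regularity) and $$\sum_{s=1}^n\tilde\nabla_s\tilde\nabla_kL\cdot F^s+\sum_{s=1}^n\nabla_s\tilde\nabla_kL\cdot v^s-\nabla_kL=0,\qquad k=1,\dots,n.$$ These are the equations $\frac{d}{dt}\frac{\partial L}{\partial \dot x^k}-\frac{\partial L}{\partial x^k}=0$ rewritten covariantly.
   Formalization: The dimension is assumed to be n ≥ 2; for n = 1 the equivalence is false: on the flat line W = v + x gives F = −|v|, which has the regular Lagrange function L = v ln v − x but is not of the form f'(x)·v². *)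

theory Defs
  imports "HOL-Analysis.Analysis"
begin

section \<open>Smooth functions on open sets\<close>

primrec higher_differentiable_on ::
  "nat \<Rightarrow> 'a::euclidean_space set \<Rightarrow> ('a \<Rightarrow> 'b::real_normed_vector) \<Rightarrow> bool" where
  "higher_differentiable_on 0 S f \<longleftrightarrow> continuous_on S f"
| "higher_differentiable_on (Suc k) S f \<longleftrightarrow>
     (\<forall>x\<in>S. f differentiable (at x)) \<and>
     (\<forall>u. higher_differentiable_on k S (\<lambda>x. frechet_derivative f (at x) u))"

text \<open>Used for open \<open>S\<close> only.\<close>
definition smooth_on :: "'a::euclidean_space set \<Rightarrow> ('a \<Rightarrow> 'b::real_normed_vector) \<Rightarrow> bool" where
  "smooth_on S f \<longleftrightarrow> (\<forall>k. higher_differentiable_on k S f)"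


section \<open>Smooth manifolds and tangent vectors\<close>

text \<open>A chart is a pair of its domain and its coordinate map; the values of the coordinate map
  outside the domain are irrelevant.\<close>
type_synonym ('m, 'n) chart = "'m set \<times> ('m \<Rightarrow> real ^ 'n)"

abbreviation cdom :: "('m, 'n) chart \<Rightarrow> 'm set" where "cdom \<equiv> fst"
abbreviation coord :: "('m, 'n) chart \<Rightarrow> 'm \<Rightarrow> real ^ 'n" where "coord \<equiv> snd"

definition cimg :: "('m, 'n) chart \<Rightarrow> (real ^ 'n) set" where
  "cimg c = coord c ` cdom c"

definition pt :: "('m, 'n) chart \<Rightarrow> real ^ 'n \<Rightarrow> 'm" where
  "pt c = inv_into (cdom c) (coord c)"

text \<open>\<open>A\<close> is a smooth atlas, not necessarily maximal, of the manifold \<open>M = topspace T\<close> of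
  dimension \<open>CARD('n)\<close>.\<close>
definition smooth_manifold ::
  "'m topology \<Rightarrow> ('m, 'n::finite) chart set \<Rightarrow> bool" where
  "smooth_manifold T A \<longleftrightarrow>
     Hausdorff_space T \<and> second_countable T \<and>
     (\<Union>c\<in>A. cdom c) = topspace T \<and>
     (\<forall>c\<in>A. openin T (cdom c) \<and> open (cimg c) \<and>
        homeomorphic_map (subtopology T (cdom c)) (top_of_set (cimg c)) (coord c)) \<and>
     (\<forall>c\<in>A. \<forall>c'\<in>A. smooth_on (coord c ` (cdom c \<inter> cdom c')) (coord c' \<circ> pt c))"

text \<open>A tangent vector at \<open>p\<close> is the family of its component vectors in all the charts around
  \<open>p\<close>, related by the transformation law of vectors (and extended by zero to the other
  pairs, so that equality of tangent vectors is equality of functions).\<close>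
type_synonym ('m, 'n) tvec = "('m, 'n) chart \<Rightarrow> real ^ 'n"

definition tangent_space :: "('m, 'n::finite) chart set \<Rightarrow> 'm \<Rightarrow> ('m, 'n) tvec set" where
  "tangent_space A p = {v.
     (\<forall>c\<in>A. \<forall>c'\<in>A. p \<in> cdom c \<longrightarrow> p \<in> cdom c' \<longrightarrow>
        v c' = frechet_derivative (coord c' \<circ> pt c) (at (coord c p)) (v c)) \<and>
     (\<forall>c. \<not> (c \<in> A \<and> p \<in> cdom c) \<longrightarrow> v c = 0)}"

definition zero_tvec :: "('m, 'n::finite) tvec" where
  "zero_tvec = (\<lambda>c. 0)"

text \<open>The tangent vector at \<open>p\<close> with components \<open>y\<close> in the chart \<open>c\<close>.\<close>
definition tvec_of ::
  "('m, 'n::finite) chart set \<Rightarrow> ('m, 'n) chart \<Rightarrow> 'm \<Rightarrow> real ^ 'n \<Rightarrow> ('m, 'n) tvec" where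
  "tvec_of A c p y = (\<lambda>c'. if c' \<in> A \<and> p \<in> cdom c'
     then frechet_derivative (coord c' \<circ> pt c) (at (coord c p)) y else 0)"

definition smooth_function :: "('m, 'n::finite) chart set \<Rightarrow> ('m \<Rightarrow> real) \<Rightarrow> bool" where
  "smooth_function A f \<longleftrightarrow> (\<forall>c\<in>A. smooth_on (cimg c) (\<lambda>x. f (pt c x)))"


section \<open>Riemannian metrics\<close>

type_synonym ('m, 'n) metric = "'m \<Rightarrow> ('m, 'n) tvec \<Rightarrow> ('m, 'n) tvec \<Rightarrow> real"

text \<open>The matrix of the components of \<open>g\<close> in the chart \<open>c\<close> at the coordinate point \<open>x\<close>.\<close>
definition gmat ::
  "('m, 'n::finite) chart set \<Rightarrow> ('m, 'n) metric \<Rightarrow> ('m, 'n) chart \<Rightarrow> real ^ 'n \<Rightarrow> real ^ 'n ^ 'n" where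
  "gmat A g c x =
     (\<chi> i j. g (pt c x) (tvec_of A c (pt c x) (axis i 1)) (tvec_of A c (pt c x) (axis j 1)))"

text \<open>The linear structure of the tangent space is the one of the components in any chart.\<close>
definition riemannian_metric :: "('m, 'n::finite) chart set \<Rightarrow> ('m, 'n) metric \<Rightarrow> bool" where
  "riemannian_metric A g \<longleftrightarrow>
     (\<forall>c\<in>A. \<forall>p\<in>cdom c.
        bilinear (\<lambda>y z. g p (tvec_of A c p y) (tvec_of A c p z)) \<and>
        (\<forall>u\<in>tangent_space A p. \<forall>v\<in>tangent_space A p. g p u v = g p v u) \<and>
        (\<forall>v\<in>tangent_space A p. v \<noteq> zero_tvec \<longrightarrow> g p v v > 0)) \<and>
     (\<forall>c\<in>A. smooth_on (cimg c) (gmat A g c))"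

definition tnorm :: "('m, 'n) metric \<Rightarrow> 'm \<Rightarrow> ('m, 'n) tvec \<Rightarrow> real" where
  "tnorm g p v = sqrt (g p v v)"

definition partial :: "'n::finite \<Rightarrow> (real ^ 'n \<Rightarrow> real) \<Rightarrow> real ^ 'n \<Rightarrow> real" where
  "partial q h z = deriv (\<lambda>t. h (z + t *\<^sub>R axis q 1)) 0"

text \<open>\<open>christoffel A g c k i j x\<close> is $\Gamma^k_{ij}$ at \<open>x\<close> for the Levi-Civita connection.\<close>
definition christoffel ::
  "('m, 'n::finite) chart set \<Rightarrow> ('m, 'n) metric \<Rightarrow> ('m, 'n) chart \<Rightarrow>
   'n \<Rightarrow> 'n \<Rightarrow> 'n \<Rightarrow> real ^ 'n \<Rightarrow> real" where
  "christoffel A g c k i j x = (1/2) * (\<Sum>l\<in>UNIV. matrix_inv (gmat A g c x) $ k $ l *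
     (partial i (\<lambda>x. gmat A g c x $ l $ j) x + partial j (\<lambda>x. gmat A g c x $ i $ l) x
      - partial l (\<lambda>x. gmat A g c x $ i $ j) x))"


section \<open>Extended fields and their covariant differentiations\<close>

text \<open>Extended fields are functions of a point and a tangent vector at it; only their values
  at nonzero tangent vectors matter. The components of an extended field in a chart are
  functions of \<open>x\<close>, the coordinates of the point, and \<open>y\<close>, the components
  $v^1,\dots,v^n$ of the tangent vector.\<close>
type_synonym ('m, 'n) ext_scalar = "'m \<Rightarrow> ('m, 'n) tvec \<Rightarrow> real"
type_synonym ('m, 'n) ext_vector = "'m \<Rightarrow> ('m, 'n) tvec \<Rightarrow> ('m, 'n) tvec"
type_synonym 'n local_scalar = "real ^ 'n \<Rightarrow> real ^ 'n \<Rightarrow> real"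

definition loc ::
  "('m, 'n::finite) chart set \<Rightarrow> ('m, 'n) chart \<Rightarrow> ('m, 'n) ext_scalar \<Rightarrow> 'n local_scalar" where
  "loc A c X = (\<lambda>x y. X (pt c x) (tvec_of A c (pt c x) y))"

definition loc_vec ::
  "('m, 'n::finite) chart set \<Rightarrow> ('m, 'n) chart \<Rightarrow> ('m, 'n) ext_vector \<Rightarrow>
   real ^ 'n \<Rightarrow> real ^ 'n \<Rightarrow> real ^ 'n" where
  "loc_vec A c X = (\<lambda>x y. X (pt c x) (tvec_of A c (pt c x) y) c)"

definition extended_scalar_field ::
  "('m, 'n::finite) chart set \<Rightarrow> ('m, 'n) ext_scalar \<Rightarrow> bool" where
  "extended_scalar_field A X \<longleftrightarrow>
     (\<forall>c\<in>A. smooth_on (cimg c \<times> (UNIV - {0})) (\<lambda>(x, y). loc A c X x y))"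

definition extended_vector_field ::
  "('m, 'n::finite) chart set \<Rightarrow> ('m, 'n) ext_vector \<Rightarrow> bool" where
  "extended_vector_field A X \<longleftrightarrow>
     (\<forall>p\<in>(\<Union>c\<in>A. cdom c). \<forall>v\<in>tangent_space A p - {zero_tvec}. X p v \<in> tangent_space A p) \<and>
     (\<forall>c\<in>A. smooth_on (cimg c \<times> (UNIV - {0})) (\<lambda>(x, y). loc_vec A c X x y))"

text \<open>The fiberwise spherically symmetric extended scalar field with $X = w(p, |v|)$.\<close>
definition spherical ::
  "('m, 'n::finite) metric \<Rightarrow> ('m \<Rightarrow> real \<Rightarrow> real) \<Rightarrow> ('m, 'n) ext_scalar" where
  "spherical g w = (\<lambda>p v. w p (tnorm g p v))"

text \<open>The index of a covariant derivative comes first: \<open>vgrad q X\<close>, \<open>sgrad A g c q X\<close> and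
  \<open>sgrad_covec A g c q X k\<close> are $\tilde\nabla_q X$, $\nabla_q X$ and $\nabla_q X_k$.\<close>
definition vgrad :: "'n::finite \<Rightarrow> 'n local_scalar \<Rightarrow> 'n local_scalar" where
  "vgrad q X = (\<lambda>x y. partial q (\<lambda>y. X x y) y)"

definition sgrad ::
  "('m, 'n::finite) chart set \<Rightarrow> ('m, 'n) metric \<Rightarrow> ('m, 'n) chart \<Rightarrow>
   'n \<Rightarrow> 'n local_scalar \<Rightarrow> 'n local_scalar" where
  "sgrad A g c q X = (\<lambda>x y. partial q (\<lambda>x. X x y) x
     - (\<Sum>a\<in>UNIV. \<Sum>b\<in>UNIV. y $ a * christoffel A g c b q a x * vgrad b X x y))"

definition sgrad_covec ::
  "('m, 'n::finite) chart set \<Rightarrow> ('m, 'n) metric \<Rightarrow> ('m, 'n) chart \<Rightarrow>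
   'n \<Rightarrow> ('n \<Rightarrow> 'n local_scalar) \<Rightarrow> 'n \<Rightarrow> 'n local_scalar" where
  "sgrad_covec A g c q X k = (\<lambda>x y. partial q (\<lambda>x. X k x y) x
     - (\<Sum>a\<in>UNIV. \<Sum>b\<in>UNIV. y $ a * christoffel A g c b q a x * vgrad b (X k) x y)
     - (\<Sum>b\<in>UNIV. christoffel A g c b q k x * X b x y))"

definition lower ::
  "('m, 'n::finite) chart set \<Rightarrow> ('m, 'n) metric \<Rightarrow> ('m, 'n) chart \<Rightarrow>
   real ^ 'n \<Rightarrow> real ^ 'n \<Rightarrow> 'n \<Rightarrow> real" where
  "lower A g c x z r = (\<Sum>s\<in>UNIV. gmat A g c x $ r $ s * z $ s)"


section \<open>Newtonian dynamical systems\<close>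

text \<open>A Newtonian dynamical system is given by its force field \<open>F\<close>.
  \<open>has_covariant_components A g F \<Phi>\<close> says that $F_r = \Phi_r$ in every chart, at all
  \<open>(p, v)\<close> with \<open>v \<noteq> 0\<close>.\<close>
definition has_covariant_components ::
  "('m, 'n::finite) chart set \<Rightarrow> ('m, 'n) metric \<Rightarrow> ('m, 'n) ext_vector \<Rightarrow>
   (('m, 'n) chart \<Rightarrow> 'n \<Rightarrow> 'n local_scalar) \<Rightarrow> bool" where
  "has_covariant_components A g F \<Phi> \<longleftrightarrow>
     (\<forall>c\<in>A. \<forall>x\<in>cimg c. \<forall>y. y \<noteq> 0 \<longrightarrow>
        (\<forall>r. lower A g c x (loc_vec A c F x y) r = \<Phi> c r x y))"

definition W_force ::
  "('m, 'n::finite) chart set \<Rightarrow> ('m, 'n) metric \<Rightarrow> ('m \<Rightarrow> real \<Rightarrow> real) \<Rightarrow>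
   ('m, 'n) chart \<Rightarrow> 'n \<Rightarrow> 'n local_scalar" where
  "W_force A g w c r = (\<lambda>x y.
     let \<nu> = tnorm g (pt c x) (tvec_of A c (pt c x) y) in
     - \<nu> * (\<Sum>s\<in>UNIV. sgrad A g c s (loc A c (spherical g w)) x y / deriv (w (pt c x)) \<nu> *
              (2 * y $ s * lower A g c x y r / \<nu>\<^sup>2 - (if s = r then 1 else 0))))"

text \<open>A function \<open>f\<close> on the manifold is treated as an extended scalar field that does not depend
  on the tangent vector.\<close>
definition f_force ::
  "('m, 'n::finite) chart set \<Rightarrow> ('m, 'n) metric \<Rightarrow> ('m \<Rightarrow> real) \<Rightarrow>
   ('m, 'n) chart \<Rightarrow> 'n \<Rightarrow> 'n local_scalar" where
  "f_force A g f c r = (\<lambda>x y.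
     let \<nu> = tnorm g (pt c x) (tvec_of A c (pt c x) y);
         f' = loc A c (\<lambda>p v. f p) in
     - \<nu>\<^sup>2 * sgrad A g c r f' x y
     + 2 * (\<Sum>s\<in>UNIV. sgrad A g c s f' x y * y $ s) * lower A g c x y r)"

text \<open>Regularity of \<open>L\<close>, and the Euler--Lagrange equations of \<open>L\<close> in covariant form along the
  solutions of the system with force field \<open>F\<close>.\<close>
definition has_lagrangian ::
  "('m, 'n::finite) chart set \<Rightarrow> ('m, 'n) metric \<Rightarrow> ('m, 'n) ext_vector \<Rightarrow>
   ('m, 'n) ext_scalar \<Rightarrow> bool" where
  "has_lagrangian A g F L \<longleftrightarrow>
     (\<forall>c\<in>A. \<forall>x\<in>cimg c. \<forall>y. y \<noteq> 0 \<longrightarrow>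
        (let l = loc A c L in
          det ((\<chi> i j. vgrad i (vgrad j l) x y) :: real ^ 'n ^ 'n) \<noteq> 0 \<and>
          (\<forall>k. (\<Sum>s\<in>UNIV. vgrad s (vgrad k l) x y * loc_vec A c F x y $ s)
             + (\<Sum>s\<in>UNIV. sgrad_covec A g c s (\<lambda>k. vgrad k l) k x y * y $ s)
             - sgrad A g c k l x y = 0)))"

end

theory Submission
  imports Defs
begin

text \<open>
  For a spherically symmetric \<open>L = l(x, \<nu>)\<close> put $m = l'/\nu$. Since the metric is covariantly
  constant, the Euler--Lagrange equations become
  $\frac{m'}{\nu}(v\cdot F)\,v_k + m F_k + (\nabla_v m)\,v_k - \nabla_k l = 0$. Inserting the force
  field of \<open>W\<close> with slope $b_k = \nabla_k W / W'$ and comparing the components orthogonal and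
  parallel to $v$ (in dimension at least 2 the direction of $v$ can be varied freely) gives
  $\nabla_k l = \nu m b_k$ and $\nabla_k m = m' b_k + 2 m b_k/\nu$. Differentiating the first
  equation in $\nu$ and comparing forces $b_k = \nu\beta_k(x)$. Then \<open>W\<close> is constant along
  the curves $\nu = \nu_0 \exp(-\int\beta)$ in the bundle of speeds, so a level set of \<open>W\<close> is the
  graph of $e^f$ with $df = -\beta$; injectivity of \<open>W\<close> in the speed makes $f$ globally single
  valued. Conversely $L = \frac12 \nu^2 e^{-2f}$ is a Lagrangian for the force field of \<open>f\<close>.
\<close>

section \<open>Calculus of smooth functions\<close>

text \<open>The force field of \<open>f\<close> is the geodesic equation of the conformal metric
  \<open>exp (-2 f) g\<close>, written with the connection of \<open>g\<close>. Hence both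
  witnesses: \<open>v exp (-f)\<close> is the speed in that metric and
  \<open>\<nu>^2 exp (-2 f) / 2\<close> its kinetic energy.

  The obstacle is global: work in a chart yields only a covector field \<open>\<beta>\<close>, while
  the manifold may be disconnected or have loops, on which even a closed covector field can lack a
  potential. So the potential is taken from \<open>W\<close> rather than integrated. The negative of
  \<open>slope\<close> is the gradient of the level sets of \<open>W\<close>, seen as graphs over
  coordinate space; once it is linear in the speed, transport along a path multiplies all speeds by
  one common factor. Such a scaling maps the half-line of speeds onto itself, so the range of
  \<open>W\<close> is the same at both ends, and a value selected from the range alone serves
  neighbouring points and all charts at once. Closedness of \<open>\<beta>\<close> is never checked;
  it follows.\<close>

lemma frechet_derivative_transform_within_open:
  fixes f g :: "'a::real_normed_vector \<Rightarrow> 'b::real_normed_vector"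
  assumes "open S" "x \<in> S" "\<And>y. y \<in> S \<Longrightarrow> f y = g y"
  shows "frechet_derivative f (at x) = frechet_derivative g (at x)"
proof -
  have "(f has_derivative D) (at x) \<longleftrightarrow> (g has_derivative D) (at x)" for D
    using assms by (metis has_derivative_transform_within_open)
  then show ?thesis by (simp add: frechet_derivative_def)
qed

lemma differentiable_transform_within_open:
  fixes f g :: "'a::real_normed_vector \<Rightarrow> 'b::real_normed_vector"
  assumes "f differentiable (at x)" "open S" "x \<in> S" "\<And>y. y \<in> S \<Longrightarrow> f y = g y"
  shows "g differentiable (at x)"
  using assms unfolding differentiable_def by (metis has_derivative_transform_within_open)

lemma higher_differentiable_on_cong:
  assumes "open S" "\<And>x. x \<in> S \<Longrightarrow> f x = g x" "higher_differentiable_on k S f"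
  shows "higher_differentiable_on k S g"
  using assms(2,3)
proof (induction k arbitrary: f g)
  case 0
  then show ?case by (simp cong: continuous_on_cong)
next
  case (Suc k)
  have "g differentiable (at x)" if "x \<in> S" for x
    using Suc.prems that assms(1) by (auto intro: differentiable_transform_within_open)
  moreover have "higher_differentiable_on k S (\<lambda>x. frechet_derivative g (at x) u)" for u
    by (rule Suc.IH[of "\<lambda>x. frechet_derivative f (at x) u"])
       (use Suc.prems assms(1) frechet_derivative_transform_within_open[of S _ f g] in auto)
  ultimately show ?case by simp
qed

text \<open>The definition refers to the chosen \<open>frechet_derivative\<close>, while calculus
  rules produce an explicit \<open>D\<close>. Uniqueness of derivatives identifies the two, on the
  whole of the open set.\<close>

lemma higher_differentiable_on_SucI:
  assumes "open S" "\<And>x. x \<in> S \<Longrightarrow> (f has_derivative D x) (at x)"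
    "\<And>u. higher_differentiable_on k S (\<lambda>x. D x u)"
  shows "higher_differentiable_on (Suc k) S f"
proof -
  have "higher_differentiable_on k S (\<lambda>x. frechet_derivative f (at x) u)" for u
    by (rule higher_differentiable_on_cong[OF assms(1) _ assms(3)[of u]]) (use assms(2) frechet_derivative_at in metis)
  then show ?thesis using assms(2) by (auto simp: differentiable_def)
qed

lemma higher_differentiable_on_SucD:
  "higher_differentiable_on (Suc k) S f \<Longrightarrow> higher_differentiable_on k S f"
proof (induction k arbitrary: f)
  case 0
  then show ?case
    by (auto intro!: continuous_at_imp_continuous_on differentiable_imp_continuous_within)
qed auto

lemma higher_differentiable_on_has_derivative:
  assumes "higher_differentiable_on (Suc k) S f" "x \<in> S"
  shows "(f has_derivative frechet_derivative f (at x)) (at x)"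
  using assms frechet_derivative_works by auto

section \<open>Closure properties at a fixed order of differentiability\<close>

lemma higher_differentiable_on_const: "open S \<Longrightarrow> higher_differentiable_on k S (\<lambda>x. c)"
  by (induction k arbitrary: c) (auto intro!: higher_differentiable_on_SucI[where D = "\<lambda>x u. 0"] continuous_on_const)

lemma higher_differentiable_on_bounded_linear:
  assumes "open S" "bounded_linear h"
  shows "higher_differentiable_on k S h"
proof (cases k)
  case 0
  then show ?thesis using assms by (simp add: linear_continuous_on)
next
  case (Suc j)
  show ?thesis unfolding Suc
    by (rule higher_differentiable_on_SucI[where D = "\<lambda>x. h"])
       (use assms in \<open>auto intro: higher_differentiable_on_const bounded_linear_imp_has_derivative\<close>)
qed

lemma higher_differentiable_on_bounded_linear_comp:
  assumes "open S" "bounded_linear h" "higher_differentiable_on k S f"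
  shows "higher_differentiable_on k S (\<lambda>x. h (f x))"
  using assms(3)
proof (induction k arbitrary: f)
  case 0
  then show ?case using assms(2) by (auto intro: bounded_linear.continuous_on)
next
  case (Suc k)
  show ?case
  proof (rule higher_differentiable_on_SucI[OF assms(1)])
    show "((\<lambda>x. h (f x)) has_derivative (\<lambda>u. h (frechet_derivative f (at x) u))) (at x)"
      if "x \<in> S" for x
      using higher_differentiable_on_has_derivative[OF Suc.prems that] assms(2) bounded_linear.has_derivative by blast
    show "higher_differentiable_on k S (\<lambda>x. h (frechet_derivative f (at x) u))" for u
      using Suc.IH Suc.prems by auto
  qed
qed

lemma higher_differentiable_on_add:
  assumes "open S" "higher_differentiable_on k S f" "higher_differentiable_on k S g"
  shows "higher_differentiable_on k S (\<lambda>x. f x + g x)"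
  using assms(2,3)
proof (induction k arbitrary: f g)
  case 0
  then show ?case by (auto intro: continuous_on_add)
next
  case (Suc k)
  show ?case
  proof (rule higher_differentiable_on_SucI[OF assms(1)])
    show "((\<lambda>x. f x + g x) has_derivative
        (\<lambda>u. frechet_derivative f (at x) u + frechet_derivative g (at x) u)) (at x)" if "x \<in> S" for x
      using higher_differentiable_on_has_derivative[OF Suc.prems(1) that] higher_differentiable_on_has_derivative[OF Suc.prems(2) that]
      by (rule has_derivative_add)
    show "higher_differentiable_on k S
        (\<lambda>x. frechet_derivative f (at x) u + frechet_derivative g (at x) u)" for u
      using Suc.IH Suc.prems by auto
  qed
qed

lemma higher_differentiable_on_sum:
  assumes "open S" "finite I" "\<And>i. i \<in> I \<Longrightarrow> higher_differentiable_on k S (f i)"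
  shows "higher_differentiable_on k S (\<lambda>x. \<Sum>i\<in>I. f i x)"
  using assms(2,3) by (induction I rule: finite_induct) (auto intro: higher_differentiable_on_const higher_differentiable_on_add assms(1))

lemma higher_differentiable_on_bilinear:
  assumes "open S" "bounded_bilinear h"
    "higher_differentiable_on k S f" "higher_differentiable_on k S g"
  shows "higher_differentiable_on k S (\<lambda>x. h (f x) (g x))"
  using assms(3,4)
proof (induction k arbitrary: f g)
  case 0
  then show ?case using bounded_bilinear.continuous_on[OF assms(2)] by auto
next
  case (Suc k)
  show ?case
  proof (rule higher_differentiable_on_SucI[OF assms(1)])
    show "((\<lambda>x. h (f x) (g x)) has_derivative
        (\<lambda>u. h (f x) (frechet_derivative g (at x) u) + h (frechet_derivative f (at x) u) (g x)))
        (at x)" if "x \<in> S" for x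
      using higher_differentiable_on_has_derivative[OF Suc.prems(1) that] higher_differentiable_on_has_derivative[OF Suc.prems(2) that]
      by (rule bounded_bilinear.FDERIV[OF assms(2)])
    show "higher_differentiable_on k S (\<lambda>x. h (f x) (frechet_derivative g (at x) u)
        + h (frechet_derivative f (at x) u) (g x))" for u
      \<comment> \<open>The product rule leaves one factor undifferentiated in each term; its order
        is lowered from \<open>Suc k\<close> to \<open>k\<close>.\<close>
      using Suc.IH Suc.prems Suc.prems[THEN higher_differentiable_on_SucD] by (intro higher_differentiable_on_add assms(1)) auto
  qed
qed

lemma higher_differentiable_on_Pair:
  assumes "open S" "higher_differentiable_on k S f" "higher_differentiable_on k S g"
  shows "higher_differentiable_on k S (\<lambda>x. (f x, g x))"
proof -
  have "bounded_linear (\<lambda>a. (a, 0))" "bounded_linear (\<lambda>b. (0, b))"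
    by (auto intro: bounded_linear_Pair bounded_linear_ident bounded_linear_zero)
  from higher_differentiable_on_add[OF assms(1) higher_differentiable_on_bounded_linear_comp[OF assms(1) this(1) assms(2)]
      higher_differentiable_on_bounded_linear_comp[OF assms(1) this(2) assms(3)]]
  show ?thesis by simp
qed

lemma higher_differentiable_on_comp:
  fixes f :: "'b::euclidean_space \<Rightarrow> 'c::real_normed_vector" and g :: "'a::euclidean_space \<Rightarrow> 'b"
  assumes "open S" "open T" "g ` S \<subseteq> T"
    "higher_differentiable_on k T f" "higher_differentiable_on k S g"
  shows "higher_differentiable_on k S (\<lambda>x. f (g x))"
  using assms(4,5)
proof (induction k arbitrary: f)
  case 0
  then show ?case using continuous_on_compose2[OF _ _ assms(3)] by auto
next
  case (Suc k)
  show ?case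
  proof (rule higher_differentiable_on_SucI[OF assms(1)])
    \<comment> \<open>In the chain rule the direction fed to the derivative of \<open>f\<close>
      varies with \<open>x\<close>, while the induction hypothesis covers fixed directions only.
      Expanding in the basis moves the variation into scalar coefficients.\<close>
    let ?D = "\<lambda>x u. \<Sum>b\<in>Basis. (frechet_derivative g (at x) u \<bullet> b) *\<^sub>R frechet_derivative f (at (g x)) b"
    show "((\<lambda>x. f (g x)) has_derivative ?D x) (at x)" if "x \<in> S" for x
    proof -
      have f: "(f has_derivative frechet_derivative f (at (g x))) (at (g x))"
        using Suc.prems(1) assms(3) that by (auto intro!: higher_differentiable_on_has_derivative[of k T])
      then have lin: "linear (frechet_derivative f (at (g x)))"
        using has_derivative_linear by blast
      have "((\<lambda>x. f (g x)) has_derivative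
          (\<lambda>u. frechet_derivative f (at (g x)) (frechet_derivative g (at x) u))) (at x)"
        using has_derivative_compose[OF higher_differentiable_on_has_derivative[OF Suc.prems(2) that] f] .
      also have "(\<lambda>u. frechet_derivative f (at (g x)) (frechet_derivative g (at x) u)) = ?D x"
        by (rule ext, subst euclidean_representation[symmetric])
           (simp only: linear_sum[OF lin] linear_scale[OF lin])
      finally show ?thesis .
    qed
    have g: "higher_differentiable_on k S g" using Suc.prems(2) higher_differentiable_on_SucD by blast
    show "higher_differentiable_on k S (\<lambda>x. ?D x u)" for u
    proof (rule higher_differentiable_on_sum[OF assms(1) finite_Basis])
      fix b :: 'b
      have "higher_differentiable_on k S (\<lambda>x. frechet_derivative g (at x) u \<bullet> b)"
        using Suc.prems(2) by (intro higher_differentiable_on_bounded_linear_comp[OF assms(1) bounded_linear_inner_left]) auto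
      moreover have "higher_differentiable_on k S (\<lambda>x. frechet_derivative f (at (g x)) b)"
        using Suc.prems(1) g by (intro Suc.IH) auto
      ultimately show "higher_differentiable_on k S
          (\<lambda>x. (frechet_derivative g (at x) u \<bullet> b) *\<^sub>R frechet_derivative f (at (g x)) b)"
        by (rule higher_differentiable_on_bilinear[OF assms(1) bounded_bilinear_scaleR])
    qed
  qed
qed

section \<open>The same properties for all orders, and composition with elementary functions\<close>

lemma smooth_on_cong:
  "open S \<Longrightarrow> smooth_on S f \<Longrightarrow> (\<And>x. x \<in> S \<Longrightarrow> f x = g x) \<Longrightarrow> smooth_on S g"
  unfolding smooth_on_def using higher_differentiable_on_cong by metis

lemma smooth_on_const: "open S \<Longrightarrow> smooth_on S (\<lambda>x. c)"
  by (simp add: smooth_on_def higher_differentiable_on_const)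

lemma smooth_on_linear: "open S \<Longrightarrow> bounded_linear h \<Longrightarrow> smooth_on S h"
  by (simp add: smooth_on_def higher_differentiable_on_bounded_linear)

lemma smooth_on_linear_comp:
  "open S \<Longrightarrow> bounded_linear h \<Longrightarrow> smooth_on S f \<Longrightarrow> smooth_on S (\<lambda>x. h (f x))"
  by (simp add: smooth_on_def higher_differentiable_on_bounded_linear_comp)

lemma smooth_on_sum:
  "open S \<Longrightarrow> finite I \<Longrightarrow> (\<And>i. i \<in> I \<Longrightarrow> smooth_on S (f i)) \<Longrightarrow> smooth_on S (\<lambda>x. \<Sum>i\<in>I. f i x)"
  by (simp add: smooth_on_def higher_differentiable_on_sum)

lemma smooth_on_scaleR:
  "open S \<Longrightarrow> smooth_on S f \<Longrightarrow> smooth_on S g \<Longrightarrow> smooth_on S (\<lambda>x. f x *\<^sub>R g x)"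
  by (simp add: smooth_on_def higher_differentiable_on_bilinear bounded_bilinear_scaleR)

lemma smooth_on_mult:
  fixes f g :: "_ \<Rightarrow> real"
  shows "open S \<Longrightarrow> smooth_on S f \<Longrightarrow> smooth_on S g \<Longrightarrow> smooth_on S (\<lambda>x. f x * g x)"
  by (simp add: smooth_on_def higher_differentiable_on_bilinear bounded_bilinear_mult)

lemma smooth_on_Pair:
  "open S \<Longrightarrow> smooth_on S f \<Longrightarrow> smooth_on S g \<Longrightarrow> smooth_on S (\<lambda>x. (f x, g x))"
  by (simp add: smooth_on_def higher_differentiable_on_Pair)

lemma smooth_on_comp:
  fixes f :: "'b::euclidean_space \<Rightarrow> 'c::real_normed_vector" and g :: "'a::euclidean_space \<Rightarrow> 'b"
  shows "open S \<Longrightarrow> open T \<Longrightarrow> g ` S \<subseteq> T \<Longrightarrow> smooth_on T f \<Longrightarrow> smooth_on S g \<Longrightarrow> smooth_on S (\<lambda>x. f (g x))"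
  unfolding smooth_on_def using higher_differentiable_on_comp by metis

lemma smooth_on_frechet_derivative:
  "smooth_on S f \<Longrightarrow> smooth_on S (\<lambda>x. frechet_derivative f (at x) u)"
  unfolding smooth_on_def by (metis higher_differentiable_on.simps(2))

lemma smooth_on_has_derivative:
  "smooth_on S f \<Longrightarrow> x \<in> S \<Longrightarrow> (f has_derivative frechet_derivative f (at x)) (at x)"
  unfolding smooth_on_def using higher_differentiable_on_has_derivative by blast

lemma smooth_on_differentiable: "smooth_on S f \<Longrightarrow> x \<in> S \<Longrightarrow> f differentiable (at x)"
  using smooth_on_has_derivative differentiable_def by blast

lemma smooth_on_continuous: "smooth_on S f \<Longrightarrow> continuous_on S f"
  unfolding smooth_on_def using higher_differentiable_on.simps(1) by blast

lemma smooth_onI_derivative: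
  assumes "open S" "\<And>x. x \<in> S \<Longrightarrow> (f has_derivative D x) (at x)" "\<And>u. smooth_on S (\<lambda>x. D x u)"
  shows "smooth_on S f"
  unfolding smooth_on_def
proof
  fix k
  have "higher_differentiable_on (Suc k) S f"
    using assms by (intro higher_differentiable_on_SucI[of S f D]) (auto simp: smooth_on_def)
  then show "higher_differentiable_on k S f" by (rule higher_differentiable_on_SucD)
qed

text \<open>Bootstrapping from an autonomous equation
  \<open>\<phi>' = \<psi> \<circ> \<phi>\<close>: the derivative of the composite is the derivative
  of \<open>h\<close> times \<open>\<psi>\<close> of the composite itself, so order \<open>k\<close>
  gives order \<open>Suc k\<close>. The exponential has \<open>\<psi> t = t\<close>, the inverse
  \<open>- t^2\<close>, the square root \<open>1 / (2 t)\<close>. Restricting to values in the range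
  keeps the last one away from \<open>t = 0\<close>.\<close>

lemma smooth_on_real_comp:
  fixes h :: "'a::euclidean_space \<Rightarrow> real" and \<phi> \<psi> :: "real \<Rightarrow> real"
  assumes "open S" "smooth_on S h"
    and D: "\<And>x. x \<in> S \<Longrightarrow> (\<phi> has_real_derivative \<psi> (\<phi> (h x))) (at (h x))"
    and \<psi>: "\<And>k f. higher_differentiable_on k S f \<Longrightarrow> (\<forall>x\<in>S. f x \<in> \<phi> ` h ` S) \<Longrightarrow>
      higher_differentiable_on k S (\<lambda>x. \<psi> (f x))"
  shows "smooth_on S (\<lambda>x. \<phi> (h x))"
proof -
  have *: "((\<lambda>x. \<phi> (h x)) has_derivative (\<lambda>u. frechet_derivative h (at x) u * \<psi> (\<phi> (h x)))) (at x)"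
    if "x \<in> S" for x
    using has_derivative_compose[OF smooth_on_has_derivative[OF assms(2) that]
        D[OF that, unfolded has_field_derivative_def]] by (simp add: mult.commute)
  have "higher_differentiable_on k S (\<lambda>x. \<phi> (h x))" for k
  proof (induction k)
    case 0
    then show ?case
      using * by (auto intro!: continuous_at_imp_continuous_on has_derivative_continuous)
  next
    case (Suc k)
    have "higher_differentiable_on k S (\<lambda>x. \<psi> (\<phi> (h x)))" by (rule \<psi>[OF Suc]) auto
    moreover have "higher_differentiable_on k S (\<lambda>x. frechet_derivative h (at x) u)" for u
      using smooth_on_frechet_derivative[OF assms(2)] by (simp add: smooth_on_def)
    ultimately show ?case
      by (intro higher_differentiable_on_SucI[OF assms(1) *] higher_differentiable_on_bilinear[OF assms(1) bounded_bilinear_mult])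
  qed
  then show ?thesis by (simp add: smooth_on_def)
qed

lemma smooth_on_exp:
  fixes h :: "'a::euclidean_space \<Rightarrow> real"
  assumes "open S" "smooth_on S h"
  shows "smooth_on S (\<lambda>x. exp (h x))"
  by (rule smooth_on_real_comp[OF assms, where \<psi> = "\<lambda>t. t"]) (auto intro: DERIV_exp)

lemma smooth_on_inverse:
  fixes h :: "'a::euclidean_space \<Rightarrow> real"
  assumes "open S" "smooth_on S h" "\<And>x. x \<in> S \<Longrightarrow> h x \<noteq> 0"
  shows "smooth_on S (\<lambda>x. inverse (h x))"
proof (rule smooth_on_real_comp[OF assms(1,2), where \<psi> = "\<lambda>t. - 1 * (t * t)"])
  show "(inverse has_real_derivative - 1 * (inverse (h x) * inverse (h x))) (at (h x))"
    if "x \<in> S" for x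
    using DERIV_inverse[OF assms(3)[OF that]] by (simp add: power2_eq_square)
qed (intro higher_differentiable_on_bilinear[OF assms(1) bounded_bilinear_mult] higher_differentiable_on_const assms(1); assumption)+

lemma smooth_on_divide:
  fixes f h :: "'a::euclidean_space \<Rightarrow> real"
  assumes "open S" "smooth_on S f" "smooth_on S h" "\<And>x. x \<in> S \<Longrightarrow> h x \<noteq> 0"
  shows "smooth_on S (\<lambda>x. f x / h x)"
  unfolding divide_inverse using assms by (intro smooth_on_mult smooth_on_inverse)

lemma smooth_on_sqrt:
  fixes h :: "'a::euclidean_space \<Rightarrow> real"
  assumes "open S" "smooth_on S h" "\<And>x. x \<in> S \<Longrightarrow> h x > 0"
  shows "smooth_on S (\<lambda>x. sqrt (h x))"
proof (rule smooth_on_real_comp[OF assms(1,2), where \<psi> = "\<lambda>t. inverse t * (1/2)"])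
  show "(sqrt has_real_derivative inverse (sqrt (h x)) * (1/2)) (at (h x))" if "x \<in> S" for x
    using DERIV_real_sqrt[OF assms(3)[OF that]] by simp
  fix k and f :: "'a \<Rightarrow> real"
  assume f: "higher_differentiable_on k S f" "\<forall>x\<in>S. f x \<in> sqrt ` h ` S"
  have pos: "\<forall>x\<in>S. f x > 0" using f(2) assms(3) by fastforce
  \<comment> \<open>Here \<open>f\<close> has only order \<open>k\<close>, so the smooth rule for
    inverses is applied to the identity on the punctured line and then composed with
    \<open>f\<close>.\<close>
  have inv: "smooth_on (- {0}) (\<lambda>t::real. inverse t)"
    by (rule smooth_on_inverse[OF _ smooth_on_linear[OF _ bounded_linear_ident]]) auto
  have "higher_differentiable_on k S (\<lambda>x. inverse (f x))"
    by (rule higher_differentiable_on_comp[of S "- {0}" f k inverse]) (use pos inv assms(1) f in \<open>auto simp: smooth_on_def\<close>)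
  then show "higher_differentiable_on k S (\<lambda>x. inverse (f x) * (1/2))"
    by (intro higher_differentiable_on_bilinear[OF assms(1) bounded_bilinear_mult] higher_differentiable_on_const assms(1))
qed


section \<open>Partial derivatives\<close>

lemma partial_eq:
  fixes h :: "real ^ 'n::finite \<Rightarrow> real"
  assumes "(h has_derivative D) (at z)"
  shows "partial q h z = D (axis q 1)"
proof -
  have "((\<lambda>t. z + t *\<^sub>R axis q 1) has_derivative (\<lambda>t. t *\<^sub>R axis q 1)) (at 0)"
    by (auto intro!: derivative_eq_intros)
  moreover have "(h has_derivative D) (at (z + 0 *\<^sub>R axis q 1))"
    using assms by simp
  ultimately have "((\<lambda>t. h (z + t *\<^sub>R axis q 1)) has_derivative (\<lambda>t. D (t *\<^sub>R axis q 1))) (at 0)"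
    by (rule has_derivative_compose)
  moreover have "D (t *\<^sub>R axis q 1) = D (axis q 1) * t" for t
    using linear_scale[OF has_derivative_linear[OF assms]] by simp
  ultimately have "((\<lambda>t. h (z + t *\<^sub>R axis q 1)) has_real_derivative D (axis q 1)) (at 0)"
    by (simp add: has_field_derivative_def)
  then show ?thesis unfolding partial_def by (rule DERIV_imp_deriv)
qed

lemma partial_cong:
  fixes h k :: "real ^ 'n::finite \<Rightarrow> real"
  assumes "open S" "z \<in> S" "\<And>x. x \<in> S \<Longrightarrow> h x = k x"
  shows "partial q h z = partial q k z"
proof -
  have "open ((\<lambda>t. z + t *\<^sub>R axis q (1::real)) -` S)"
    by (intro open_vimage assms(1) continuous_intros)
  then have "\<forall>\<^sub>F t in nhds 0. z + t *\<^sub>R axis q 1 \<in> S"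
    unfolding eventually_nhds using assms(2) by (intro exI conjI) auto
  then have "\<forall>\<^sub>F t in nhds 0. h (z + t *\<^sub>R axis q 1) = k (z + t *\<^sub>R axis q 1)"
    by eventually_elim (rule assms(3))
  then show ?thesis unfolding partial_def by (intro deriv_cong_ev) auto
qed

lemma vec_basis_sum:
  fixes y :: "real ^ 'n::finite"
  shows "y = (\<Sum>i\<in>UNIV. (y $ i) *\<^sub>R axis i 1)"
  by (simp add: vec_eq_iff axis_def if_distrib[of "\<lambda>t. _ * t"] cong: if_cong)

lemma bilinear_components:
  fixes h :: "real ^ 'n::finite \<Rightarrow> real ^ 'n \<Rightarrow> real"
  assumes "bilinear h"
  shows "h y z = y \<bullet> ((\<chi> i j. h (axis i 1) (axis j 1)) *v z)"
proof -
  have "h y z = h (\<Sum>i\<in>UNIV. (y $ i) *\<^sub>R axis i 1) (\<Sum>j\<in>UNIV. (z $ j) *\<^sub>R axis j 1)"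
    using vec_basis_sum[of y] vec_basis_sum[of z] by simp
  also have "\<dots> = (\<Sum>(i, j)\<in>UNIV \<times> UNIV. h ((y $ i) *\<^sub>R axis i 1) ((z $ j) *\<^sub>R axis j 1))"
    by (simp add: bilinear_sum[OF assms])
  also have "\<dots> = y \<bullet> ((\<chi> i j. h (axis i 1) (axis j 1)) *v z)"
    unfolding sum.cartesian_product[symmetric]
    by (simp add: bilinear_lmul[OF assms] bilinear_rmul[OF assms] inner_vec_def matrix_vector_mult_def sum_distrib_left mult_ac)
  finally show ?thesis .
qed


section \<open>Riemannian geometry in a chart\<close>

text \<open>All analysis takes place in one chart. Transition maps matter only for seeing that
  \<open>tvec_of\<close> yields genuine tangent vectors.\<close>

locale riemannian_chart =
  fixes T :: "'m topology" and A :: "('m, 'n::finite) chart set" and g :: "('m, 'n) metric"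
    and c :: "('m, 'n) chart"
  assumes manifold: "smooth_manifold T A"
    and metric: "riemannian_metric A g"
    and chart: "c \<in> A"
begin

abbreviation "U \<equiv> cimg c"
abbreviation "G \<equiv> gmat A g c"
abbreviation "\<Gamma> \<equiv> christoffel A g c"
abbreviation "\<nu> \<equiv> \<lambda>x y. tnorm g (pt c x) (tvec_of A c (pt c x) y)"

lemma pt_in: "x \<in> U \<Longrightarrow> pt c x \<in> cdom c"
  by (auto simp: cimg_def pt_def inv_into_into)

lemma open_U: "open U"
  using manifold chart by (auto simp: smooth_manifold_def)

end

section \<open>Transition maps and tangent vectors\<close>

lemma pt_coord:
  assumes "smooth_manifold T A" "c \<in> A" "p \<in> cdom c"
  shows "pt c (coord c p) = p"
proof -
  have "homeomorphic_map (subtopology T (cdom c)) (top_of_set (cimg c)) (coord c)"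
    "openin T (cdom c)"
    using assms by (auto simp: smooth_manifold_def)
  then have "inj_on (coord c) (cdom c)"
    using homeomorphic_imp_injective_map openin_subset topspace_subtopology_subset by metis
  then show ?thesis unfolding pt_def using assms(3) by simp
qed

lemma open_chart_overlap:
  assumes "smooth_manifold T A" "c \<in> A" "c' \<in> A"
  shows "open (coord c ` (cdom c \<inter> cdom c'))"
proof -
  have c: "homeomorphic_map (subtopology T (cdom c)) (top_of_set (cimg c)) (coord c)"
    "openin T (cdom c)" "openin T (cdom c')" "open (cimg c)"
    using assms by (auto simp: smooth_manifold_def)
  then have "openin (subtopology T (cdom c)) (cdom c \<inter> cdom c')"
    by (meson Int_lower1 openin_Int openin_subtopology_alt openin_subset_topspace_eq openin_open_subtopology)
  then have "openin (top_of_set (cimg c)) (coord c ` (cdom c \<inter> cdom c'))"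
    using c(1) homeomorphic_imp_open_map open_map_def by blast
  then show ?thesis using c(4) openin_open_eq by blast
qed

lemma transition_has_derivative:
  assumes "smooth_manifold T A" "c \<in> A" "c' \<in> A" "p \<in> cdom c" "p \<in> cdom c'"
  shows "((coord c' \<circ> pt c) has_derivative
    frechet_derivative (coord c' \<circ> pt c) (at (coord c p))) (at (coord c p))"
  by (rule smooth_on_has_derivative[of "coord c ` (cdom c \<inter> cdom c')"])
     (use assms in \<open>auto simp: smooth_manifold_def\<close>)

lemma tvec_of_same:
  assumes "smooth_manifold T A" "c \<in> A" "p \<in> cdom c"
  shows "tvec_of A c p y c = y"
proof -
  have "frechet_derivative (coord c \<circ> pt c) (at (coord c p)) = frechet_derivative (\<lambda>x. x) (at (coord c p))"
  proof (rule frechet_derivative_transform_within_open)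
    show "open (cimg c)" using assms by (auto simp: smooth_manifold_def)
    show "coord c p \<in> cimg c" using assms(3) by (auto simp: cimg_def)
    show "(coord c \<circ> pt c) x = x" if "x \<in> cimg c" for x
      using that by (auto simp: cimg_def pt_def f_inv_into_f)
  qed
  then show ?thesis using assms by (simp add: tvec_of_def)
qed

text \<open>The transformation law is the chain rule for a transition map factored through a third
  chart; the factorisation holds on the overlap, which is open. This gives access to symmetry and
  positivity of the metric, which are postulated on \<open>tangent_space\<close>.\<close>

lemma tvec_of_in_tangent_space:
  assumes "smooth_manifold T A" "c \<in> A" "p \<in> cdom c"
  shows "tvec_of A c p y \<in> tangent_space A p"
proof -
  have "frechet_derivative (coord c2 \<circ> pt c) (at (coord c p)) =
      (\<lambda>y. frechet_derivative (coord c2 \<circ> pt c1) (at (coord c1 p))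
        (frechet_derivative (coord c1 \<circ> pt c) (at (coord c p)) y))" (is "_ = ?D")
    if c12: "c1 \<in> A" "c2 \<in> A" "p \<in> cdom c1" "p \<in> cdom c2" for c1 c2
  proof -
    have p: "(coord c1 \<circ> pt c) (coord c p) = coord c1 p"
      using pt_coord assms by fastforce
    have "((\<lambda>x. (coord c2 \<circ> pt c1) ((coord c1 \<circ> pt c) x)) has_derivative ?D) (at (coord c p))"
      using has_derivative_compose[OF transition_has_derivative[OF assms(1,2) c12(1) assms(3) c12(3)]]
        transition_has_derivative[OF assms(1) c12] p by metis
    moreover have "(coord c2 \<circ> pt c1) ((coord c1 \<circ> pt c) x) = (coord c2 \<circ> pt c) x"
      if "x \<in> coord c ` (cdom c \<inter> cdom c1)" for x
      using that pt_coord[OF assms(1,2)] pt_coord[OF assms(1) c12(1)] by auto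
    ultimately have "((coord c2 \<circ> pt c) has_derivative ?D) (at (coord c p))"
      using has_derivative_transform_within_open[OF _ open_chart_overlap[OF assms(1,2) c12(1)]]
        assms(3) c12(3) by blast
    then show ?thesis using frechet_derivative_at by metis
  qed
  note comp = this
  have "tvec_of A c p y c2 = frechet_derivative (coord c2 \<circ> pt c1) (at (coord c1 p)) (tvec_of A c p y c1)"
    if "c1 \<in> A" "c2 \<in> A" "p \<in> cdom c1" "p \<in> cdom c2" for c1 c2
    using that fun_cong[OF comp[OF that], of y] unfolding tvec_of_def by presburger
  moreover have "tvec_of A c p y c' = 0" if "\<not> (c' \<in> A \<and> p \<in> cdom c')" for c'
    using that by (simp add: tvec_of_def del: de_Morgan_conj)
  ultimately show ?thesis unfolding tangent_space_def by blast
qed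

context riemannian_chart
begin

lemma g_components:
  assumes "x \<in> U"
  shows "g (pt c x) (tvec_of A c (pt c x) y) (tvec_of A c (pt c x) z) = y \<bullet> (G x *v z)"
proof -
  have "bilinear (\<lambda>y z. g (pt c x) (tvec_of A c (pt c x) y) (tvec_of A c (pt c x) z))"
    using metric chart pt_in[OF assms] unfolding riemannian_metric_def by blast
  from bilinear_components[OF this, of y z] show ?thesis unfolding gmat_def .
qed

lemma g_sym:
  assumes "x \<in> U"
  shows "g (pt c x) (tvec_of A c (pt c x) y) (tvec_of A c (pt c x) z) =
    g (pt c x) (tvec_of A c (pt c x) z) (tvec_of A c (pt c x) y)"
proof -
  have "\<forall>u\<in>tangent_space A (pt c x). \<forall>v\<in>tangent_space A (pt c x). g (pt c x) u v = g (pt c x) v u"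
    using metric chart pt_in[OF assms] unfolding riemannian_metric_def by blast
  then show ?thesis using tvec_of_in_tangent_space[OF manifold chart pt_in[OF assms]] by blast
qed

lemma G_sym: "x \<in> U \<Longrightarrow> G x $ i $ j = G x $ j $ i"
  unfolding gmat_def by (simp only: vec_lambda_beta) (rule g_sym)

lemma inner_G_sym: "x \<in> U \<Longrightarrow> y \<bullet> (G x *v z) = z \<bullet> (G x *v y)"
  by (simp only: g_components[symmetric]) (rule g_sym)

lemma G_pos:
  assumes "x \<in> U" "y \<noteq> 0"
  shows "y \<bullet> (G x *v y) > 0"
proof -
  have "tvec_of A c (pt c x) y \<noteq> zero_tvec"
    using tvec_of_same[OF manifold chart pt_in[OF assms(1)], of y] assms(2)
    by (auto simp: zero_tvec_def)
  then show ?thesis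
    using metric chart pt_in[OF assms(1)] tvec_of_in_tangent_space[OF manifold chart pt_in[OF assms(1)]]
    unfolding riemannian_metric_def g_components[OF assms(1), symmetric] by blast
qed

lemma \<nu>_eq: "x \<in> U \<Longrightarrow> \<nu> x y = sqrt (y \<bullet> (G x *v y))"
  by (simp add: tnorm_def g_components)

lemma \<nu>_pos: "x \<in> U \<Longrightarrow> y \<noteq> 0 \<Longrightarrow> \<nu> x y > 0"
  by (simp add: \<nu>_eq G_pos)

lemma \<nu>_sq: 
  assumes "x \<in> U" shows "(\<nu> x y)\<^sup>2 = y \<bullet> (G x *v y)"
  using G_pos[OF assms, of y] by (cases "y = 0") (auto simp: \<nu>_eq[OF assms])

lemma \<nu>_scale: "x \<in> U \<Longrightarrow> \<nu> x (t *\<^sub>R y) = \<bar>t\<bar> * \<nu> x y"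
  by (simp add: \<nu>_eq matrix_vector_mult_scaleR real_sqrt_mult)

lemma lower_eq: "lower A g c x y r = (G x *v y) $ r"
  by (simp add: lower_def matrix_vector_mult_def)

lemma G_smooth: "smooth_on U G"
  using metric chart by (auto simp: riemannian_metric_def)

lemma invertible_G: 
  assumes "x \<in> U" shows "invertible (G x)"
proof -
  have "y = 0" if "G x *v y = 0" for y using G_pos[OF assms, of y] that by fastforce
  then show ?thesis
    using invertible_left_inverse matrix_left_invertible_ker by blast
qed

lemma G_matrix_inv: 
  assumes "x \<in> U"
  shows "(\<Sum>b\<in>UNIV. G x $ k $ b * matrix_inv (G x) $ b $ l) = (if k = l then 1 else 0)"
proof -
  have "G x ** matrix_inv (G x) = mat 1 \<and> matrix_inv (G x) ** G x = mat 1"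
    using invertible_G[OF assms] unfolding invertible_def matrix_inv_def by (rule someI_ex)
  then have "(G x ** matrix_inv (G x)) $ k $ l = (mat 1 :: real^'n^'n) $ k $ l" by simp
  then show ?thesis by (simp add: matrix_matrix_mult_def mat_def)
qed

text \<open>Lowering the upper index cancels the inverse metric and leaves the Christoffel symbols
  of the first kind.\<close>

lemma lower_christoffel:
  assumes "x \<in> U"
  shows "(\<Sum>b\<in>UNIV. G x $ k $ b * \<Gamma> b i j x) = (1/2) * (partial i (\<lambda>x. G x $ k $ j) x
     + partial j (\<lambda>x. G x $ i $ k) x - partial k (\<lambda>x. G x $ i $ j) x)"
proof -
  let ?d = "\<lambda>l. partial i (\<lambda>x. G x $ l $ j) x + partial j (\<lambda>x. G x $ i $ l) x
      - partial l (\<lambda>x. G x $ i $ j) x"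
  have "(\<Sum>b\<in>UNIV. G x $ k $ b * \<Gamma> b i j x) =
      (\<Sum>b\<in>UNIV. \<Sum>l\<in>UNIV. (1/2) * (G x $ k $ b * matrix_inv (G x) $ b $ l) * ?d l)"
    by (simp add: christoffel_def sum_distrib_left mult.assoc mult.left_commute)
  also have "\<dots> = (\<Sum>l\<in>UNIV. (1/2) * (\<Sum>b\<in>UNIV. G x $ k $ b * matrix_inv (G x) $ b $ l) * ?d l)"
    by (subst sum.swap) (simp add: sum_distrib_left sum_distrib_right)
  also have "\<dots> = (\<Sum>l\<in>UNIV. if k = l then (1/2) * ?d l else 0)"
    unfolding G_matrix_inv[OF assms] by (intro sum.cong) auto
  finally show ?thesis by simp
qed

lemma G_has_derivative:
  "x \<in> U \<Longrightarrow> (G has_derivative frechet_derivative G (at x)) (at x)"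
  by (rule smooth_on_has_derivative[OF G_smooth])

lemma partial_G:
  assumes "x \<in> U"
  shows "partial q (\<lambda>x. G x $ i $ j) x = frechet_derivative G (at x) (axis q 1) $ i $ j"
  by (rule partial_eq) (auto intro!: bounded_linear.has_derivative[OF bounded_linear_vec_nth] G_has_derivative assms)

text \<open>Add two Christoffel symbols of the first kind: by symmetry of the metric all derivatives
  cancel except the wanted one, which occurs twice with factor one half.\<close>

lemma metric_compatible:
  assumes "x \<in> U"
  shows "partial s (\<lambda>x. G x $ k $ a) x =
    (\<Sum>b\<in>UNIV. \<Gamma> b s a x * G x $ k $ b) + (\<Sum>b\<in>UNIV. \<Gamma> b s k x * G x $ b $ a)"
proof -
  have sym: "partial q (\<lambda>x. G x $ i $ j) x = partial q (\<lambda>x. G x $ j $ i) x" for q i j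
    by (rule partial_cong[OF open_U assms G_sym])
  have "(\<Sum>b\<in>UNIV. \<Gamma> b s k x * G x $ b $ a) = (\<Sum>b\<in>UNIV. G x $ a $ b * \<Gamma> b s k x)"
    using G_sym[OF assms] by (simp add: mult.commute)
  moreover have "(\<Sum>b\<in>UNIV. \<Gamma> b s a x * G x $ k $ b) = (\<Sum>b\<in>UNIV. G x $ k $ b * \<Gamma> b s a x)"
    by (simp add: mult.commute)
  ultimately show ?thesis
    using lower_christoffel[OF assms, of k s a] lower_christoffel[OF assms, of a s k]
      sym[of s a k] sym[of k s a] sym[of a k s] by simp
qed

text \<open>Contract \<open>metric_compatible\<close> twice with \<open>y\<close>. The two resulting
  sums differ only by exchanging the names of the contracted indices, which explains the factor one
  half.\<close>

lemma quadratic_christoffel: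
  assumes "x \<in> U"
  shows "(\<Sum>a\<in>UNIV. \<Sum>b\<in>UNIV. y $ a * \<Gamma> b q a x * (G x *v y) $ b) =
    y \<bullet> (frechet_derivative G (at x) (axis q 1) *v y) / 2"
proof -
  have 1: "y \<bullet> (frechet_derivative G (at x) (axis q 1) *v y) =
      (\<Sum>d\<in>UNIV. \<Sum>a\<in>UNIV. \<Sum>b\<in>UNIV. y $ d * (\<Gamma> b q a x * G x $ d $ b) * y $ a) +
      (\<Sum>d\<in>UNIV. \<Sum>a\<in>UNIV. \<Sum>b\<in>UNIV. y $ d * (\<Gamma> b q d x * G x $ b $ a) * y $ a)"
    by (simp add: inner_vec_def matrix_vector_mult_def partial_G[OF assms, symmetric]
        metric_compatible[OF assms] sum_distrib_left sum_distrib_right algebra_simps sum.distrib)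
  have "(\<Sum>d\<in>UNIV. \<Sum>a\<in>UNIV. \<Sum>b\<in>UNIV. y $ d * (\<Gamma> b q a x * G x $ d $ b) * y $ a) =
      (\<Sum>d\<in>UNIV. \<Sum>a\<in>UNIV. \<Sum>b\<in>UNIV. y $ d * (\<Gamma> b q d x * G x $ b $ a) * y $ a)"
    by (subst sum.swap) (simp add: G_sym[OF assms] mult_ac)
  moreover have "(\<Sum>a\<in>UNIV. \<Sum>b\<in>UNIV. y $ a * \<Gamma> b q a x * (G x *v y) $ b) =
      (\<Sum>d\<in>UNIV. \<Sum>a\<in>UNIV. \<Sum>b\<in>UNIV. y $ d * (\<Gamma> b q d x * G x $ b $ a) * y $ a)"
    by (simp add: matrix_vector_mult_def sum_distrib_left mult_ac, subst (2) sum.swap) simp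
  ultimately show ?thesis using 1 by simp
qed

end


section \<open>Gradients of spherically symmetric fields\<close>

text \<open>A point of the product is a coordinate point together with a speed. Thus
  \<open>d_space\<close> keeps the speed fixed, whereas a partial derivative in \<open>x\<close> of
  an extended field keeps the components of the velocity fixed.\<close>

abbreviation d_space :: "'n::finite \<Rightarrow> ((real ^ 'n) \<times> real \<Rightarrow> real) \<Rightarrow> (real ^ 'n) \<times> real \<Rightarrow> real" where
  "d_space q h z \<equiv> frechet_derivative h (at z) (axis q 1, 0)"

abbreviation d_speed :: "((real ^ 'n::finite) \<times> real \<Rightarrow> real) \<Rightarrow> (real ^ 'n) \<times> real \<Rightarrow> real" where
  "d_speed h z \<equiv> frechet_derivative h (at z) (0, 1)"

lemma linear_pair_split:
  fixes D :: "'a::real_vector \<times> real \<Rightarrow> real"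
  assumes "linear D"
  shows "D (a, b) = D (a, 0) + b * D (0, 1)"
proof -
  have "D (a, b) = D ((a, 0) + b *\<^sub>R (0, 1))" by simp
  then show ?thesis by (simp only: linear_add[OF assms] linear_scale[OF assms] real_scaleR_def)
qed

lemma frechet_derivative_pair_split:
  assumes "h differentiable (at z)"
  shows "frechet_derivative h (at z) (a, b) =
    (frechet_derivative h (at z) (a, 0) :: real) + b * frechet_derivative h (at z) (0, 1)"
  using linear_pair_split linear_frechet_derivative assms by blast

lemma frechet_derivative_speed:
  assumes "h differentiable (at z)"
  shows "frechet_derivative h (at z) (0, b) = (b * frechet_derivative h (at z) (0, 1) :: real)"
  unfolding frechet_derivative_pair_split[OF assms, of 0 b]
  using linear_0[OF linear_frechet_derivative[OF assms]] by (simp add: zero_prod_def)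

lemma smooth_on_speed_section:
  assumes "smooth_on (S \<times> {0<..}) h" "x \<in> S" "t > 0"
  shows "((\<lambda>t. h (x, t)) has_real_derivative d_speed h (x, t)) (at t)"
proof -
  have h: "(h has_derivative frechet_derivative h (at (x, t))) (at (x, t))"
    using assms by (auto intro: smooth_on_has_derivative)
  have "((\<lambda>t. (x, t)) has_derivative (\<lambda>u. (0, u))) (at t)"
    by (auto intro!: derivative_eq_intros)
  from has_derivative_compose[OF this h]
  have "((\<lambda>t. h (x, t)) has_derivative (\<lambda>u. frechet_derivative h (at (x, t)) (0, u))) (at t)" .
  moreover have "(\<lambda>u. frechet_derivative h (at (x, t)) (0, u)) = (*) (d_speed h (x, t))"
  proof
    show "frechet_derivative h (at (x, t)) (0, u) = d_speed h (x, t) * u" for u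
      using frechet_derivative_speed[OF differentiableI[OF h], of u] by (simp only: mult.commute)
  qed
  ultimately show ?thesis by (simp only: has_field_derivative_def)
qed

context riemannian_chart
begin

lemma \<nu>_has_derivative_velocity:
  assumes "x \<in> U" "y \<noteq> 0"
  shows "((\<lambda>y. \<nu> x y) has_derivative (\<lambda>u. u \<bullet> (G x *v y) / \<nu> x y)) (at y)"
proof -
  have "((\<lambda>y. y \<bullet> (G x *v y)) has_derivative (\<lambda>u. y \<bullet> (G x *v u) + u \<bullet> (G x *v y))) (at y)"
    by (intro has_derivative_inner has_derivative_ident
        bounded_linear_imp_has_derivative[OF matrix_vector_mul_bounded_linear])
  then have "((\<lambda>y. y \<bullet> (G x *v y)) has_derivative (\<lambda>u. 2 * (u \<bullet> (G x *v y)))) (at y)"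
    using inner_G_sym[OF assms(1), of y] by simp
  from has_derivative_compose[OF this DERIV_real_sqrt[OF G_pos[OF assms], unfolded has_field_derivative_def]]
  show ?thesis unfolding \<nu>_eq[OF assms(1)] by (simp add: field_simps)
qed

lemma \<nu>_has_derivative_space:
  assumes "x \<in> U" "y \<noteq> 0"
  shows "((\<lambda>x. \<nu> x y) has_derivative
    (\<lambda>u. y \<bullet> (frechet_derivative G (at x) u *v y) / (2 * \<nu> x y))) (at x)"
proof -
  have "linear (\<lambda>M::real^'n^'n. y \<bullet> (M *v y))"
    by (rule linearI) (simp_all add: matrix_vector_mult_add_rdistrib inner_add_right
        scaleR_matrix_vector_assoc[symmetric])
  then have "((\<lambda>x. y \<bullet> (G x *v y)) has_derivative
      (\<lambda>u. y \<bullet> (frechet_derivative G (at x) u *v y))) (at x)"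
    using G_has_derivative[OF assms(1)]
    by (auto simp: linear_linear intro: bounded_linear.has_derivative)
  from has_derivative_compose[OF this DERIV_real_sqrt[OF G_pos[OF assms], unfolded has_field_derivative_def]]
  have "((\<lambda>x. sqrt (y \<bullet> (G x *v y))) has_derivative
    (\<lambda>u. y \<bullet> (frechet_derivative G (at x) u *v y) / (2 * \<nu> x y))) (at x)"
    unfolding \<nu>_eq[OF assms(1)] by (simp add: field_simps)
  then show ?thesis
    by (rule has_derivative_transform_within_open[OF _ open_U assms(1)]) (simp add: \<nu>_eq)
qed

lemma vgrad_spherical:
  assumes "x \<in> U" "y \<noteq> 0" "h differentiable (at (x, \<nu> x y))"
    and X: "\<And>y. y \<noteq> 0 \<Longrightarrow> X x y = h (x, \<nu> x y)"
  shows "vgrad k X x y = d_speed h (x, \<nu> x y) * (G x *v y) $ k / \<nu> x y"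
proof -
  have "((\<lambda>y. (x, \<nu> x y)) has_derivative (\<lambda>u. (0, u \<bullet> (G x *v y) / \<nu> x y))) (at y)"
    using \<nu>_has_derivative_velocity[OF assms(1,2)] by (intro has_derivative_Pair has_derivative_const)
  from has_derivative_compose[OF this assms(3)[unfolded frechet_derivative_works]]
  have "partial k (\<lambda>y. h (x, \<nu> x y)) y =
      frechet_derivative h (at (x, \<nu> x y)) (0, axis k 1 \<bullet> (G x *v y) / \<nu> x y)"
    by (rule partial_eq)
  also have "\<dots> = d_speed h (x, \<nu> x y) * (G x *v y) $ k / \<nu> x y"
    by (subst frechet_derivative_speed[OF assms(3)]) (simp add: inner_axis')
  also have "partial k (\<lambda>y. h (x, \<nu> x y)) y = partial k (X x) y"
    by (rule partial_cong[of "- {0}"]) (use assms(2) X in auto)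
  finally show ?thesis by (simp add: vgrad_def)
qed

text \<open>At fixed components \<open>y\<close> the speed still varies with \<open>x\<close>
  through the metric. By \<open>quadratic_christoffel\<close> the connection term of the spatial
  gradient removes exactly this contribution.\<close>

lemma sgrad_spherical:
  assumes "x \<in> U" "y \<noteq> 0" "h differentiable (at (x, \<nu> x y))"
    and X: "\<And>x y. x \<in> U \<Longrightarrow> y \<noteq> 0 \<Longrightarrow> X x y = h (x, \<nu> x y)"
  shows "sgrad A g c q X x y = d_space q h (x, \<nu> x y)"
proof -
  let ?n = "\<lambda>u. y \<bullet> (frechet_derivative G (at x) u *v y) / (2 * \<nu> x y)"
  let ?dt = "d_speed h (x, \<nu> x y)"
  have "((\<lambda>x. (x, \<nu> x y)) has_derivative (\<lambda>u. (u, ?n u))) (at x)"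
    using \<nu>_has_derivative_space[OF assms(1,2)] by (intro has_derivative_Pair has_derivative_ident)
  from has_derivative_compose[OF this assms(3)[unfolded frechet_derivative_works]]
  have "partial q (\<lambda>x. h (x, \<nu> x y)) x =
      frechet_derivative h (at (x, \<nu> x y)) (axis q 1, ?n (axis q 1))"
    by (rule partial_eq)
  also have "partial q (\<lambda>x. h (x, \<nu> x y)) x = partial q (\<lambda>x. X x y) x"
    by (rule partial_cong[OF open_U assms(1)]) (use assms(2) X in auto)
  also have "frechet_derivative h (at (x, \<nu> x y)) (axis q 1, ?n (axis q 1)) =
      d_space q h (x, \<nu> x y) + ?n (axis q 1) * ?dt"
    by (rule frechet_derivative_pair_split[OF assms(3)])
  finally have 1: "partial q (\<lambda>x. X x y) x = d_space q h (x, \<nu> x y) + ?n (axis q 1) * ?dt" .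
  have v: "vgrad b X x y = ?dt * (G x *v y) $ b / \<nu> x y" for b
    by (rule vgrad_spherical[OF assms(1-3)], rule X[OF assms(1)])
  have "(\<Sum>a\<in>UNIV. \<Sum>b\<in>UNIV. y $ a * \<Gamma> b q a x * vgrad b X x y) =
      (\<Sum>a\<in>UNIV. \<Sum>b\<in>UNIV. y $ a * \<Gamma> b q a x * (G x *v y) $ b) * (?dt / \<nu> x y)"
    unfolding v sum_distrib_right by (intro sum.cong refl) simp
  also have "\<dots> = ?n (axis q 1) * ?dt"
    unfolding quadratic_christoffel[OF assms(1)] by simp
  finally show ?thesis unfolding sgrad_def 1 by simp
qed

text \<open>\<open>metric_compatible\<close> contracted with \<open>y\<close>. The right side
  consists of the two connection terms that \<open>sgrad_covec\<close> subtracts, so the lowered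
  velocity has vanishing spatial gradient.\<close>

lemma partial_lower:
  assumes "x \<in> U"
  shows "partial s (\<lambda>x. (G x *v y) $ k) x =
      (\<Sum>a\<in>UNIV. \<Sum>b\<in>UNIV. y $ a * \<Gamma> b s a x * G x $ k $ b) + (\<Sum>b\<in>UNIV. \<Gamma> b s k x * (G x *v y) $ b)"
proof -
  have "((\<lambda>x. (G x *v y) $ k) has_derivative (\<lambda>u. \<Sum>a\<in>UNIV. frechet_derivative G (at x) u $ k $ a * y $ a)) (at x)"
    unfolding matrix_vector_mult_def vec_lambda_beta
    by (intro has_derivative_sum has_derivative_mult_left bounded_linear.has_derivative[OF bounded_linear_vec_nth]
        G_has_derivative assms)
  then have "partial s (\<lambda>x. (G x *v y) $ k) x = (\<Sum>a\<in>UNIV. partial s (\<lambda>x. G x $ k $ a) x * y $ a)"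
    unfolding partial_G[OF assms] by (rule partial_eq)
  also have "\<dots> = (\<Sum>a\<in>UNIV. \<Sum>b\<in>UNIV. y $ a * \<Gamma> b s a x * G x $ k $ b)
      + (\<Sum>a\<in>UNIV. \<Sum>b\<in>UNIV. \<Gamma> b s k x * (G x $ b $ a * y $ a))"
    unfolding metric_compatible[OF assms]
    by (simp add: algebra_simps sum.distrib sum_distrib_left sum_distrib_right)
  also have "(\<Sum>a\<in>UNIV. \<Sum>b\<in>UNIV. \<Gamma> b s k x * (G x $ b $ a * y $ a)) = (\<Sum>b\<in>UNIV. \<Gamma> b s k x * (G x *v y) $ b)"
    by (subst sum.swap) (simp add: matrix_vector_mult_def sum_distrib_left)
  finally show ?thesis .
qed

lemma lower_has_derivative:
  "((\<lambda>y. (G x *v y) $ k) has_derivative (\<lambda>u. (G x *v u) $ k)) (at y)"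
  by (intro bounded_linear_imp_has_derivative bounded_linear_compose[OF bounded_linear_vec_nth]
      matrix_vector_mul_bounded_linear)

lemma vgrad_spherical_lower:
  assumes "x \<in> U" "y \<noteq> 0" "h differentiable (at (x, \<nu> x y))"
    and X: "\<And>y. y \<noteq> 0 \<Longrightarrow> X x y = h (x, \<nu> x y) * (G x *v y) $ k"
  shows "vgrad s X x y = d_speed h (x, \<nu> x y) * (G x *v y) $ s * (G x *v y) $ k / \<nu> x y
    + h (x, \<nu> x y) * G x $ k $ s"
proof -
  let ?D = "frechet_derivative h (at (x, \<nu> x y))"
  have "((\<lambda>y. (x, \<nu> x y)) has_derivative (\<lambda>u. (0, u \<bullet> (G x *v y) / \<nu> x y))) (at y)"
    using \<nu>_has_derivative_velocity[OF assms(1,2)] by (intro has_derivative_Pair has_derivative_const)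
  from has_derivative_compose[OF this assms(3)[unfolded frechet_derivative_works]]
  have h: "((\<lambda>y. h (x, \<nu> x y)) has_derivative (\<lambda>u. ?D (0, u \<bullet> (G x *v y) / \<nu> x y))) (at y)" .
  have "partial s (\<lambda>y. h (x, \<nu> x y)) y = vgrad s (\<lambda>x y. h (x, \<nu> x y)) x y"
    by (simp add: vgrad_def)
  then have "?D (0, axis s 1 \<bullet> (G x *v y) / \<nu> x y) = d_speed h (x, \<nu> x y) * (G x *v y) $ s / \<nu> x y"
    using vgrad_spherical[OF assms(1-3), of "\<lambda>x y. h (x, \<nu> x y)" s] partial_eq[OF h, of s] by simp
  moreover have "(G x *v axis s 1) $ k = G x $ k $ s"
    by (simp add: matrix_vector_mult_basis column_def)
  moreover have "partial s (X x) y = partial s (\<lambda>y. h (x, \<nu> x y) * (G x *v y) $ k) y"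
    by (rule partial_cong[of "- {0}"]) (use assms(2) X in auto)
  ultimately show ?thesis
    using partial_eq[OF has_derivative_mult[OF h lower_has_derivative[where k = k]], of s]
    by (simp add: vgrad_def)
qed

text \<open>The lowered velocity components are covariantly constant, so only the radial factor is
  differentiated.\<close>

lemma sgrad_covec_spherical_lower:
  assumes "x \<in> U" "y \<noteq> 0" "h differentiable (at (x, \<nu> x y))"
    and X: "\<And>x y k. x \<in> U \<Longrightarrow> y \<noteq> 0 \<Longrightarrow> X k x y = h (x, \<nu> x y) * (G x *v y) $ k"
  shows "sgrad_covec A g c s X k x y = d_space s h (x, \<nu> x y) * (G x *v y) $ k"
proof -
  let ?n = "\<lambda>u. y \<bullet> (frechet_derivative G (at x) u *v y) / (2 * \<nu> x y)"
  let ?H = "\<lambda>x y. h (x, \<nu> x y)"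
  let ?D = "frechet_derivative h (at (x, \<nu> x y))"
  have "((\<lambda>x. (x, \<nu> x y)) has_derivative (\<lambda>u. (u, ?n u))) (at x)"
    using \<nu>_has_derivative_space[OF assms(1,2)] by (intro has_derivative_Pair has_derivative_ident)
  from has_derivative_compose[OF this assms(3)[unfolded frechet_derivative_works]]
  have h: "((\<lambda>x. ?H x y) has_derivative (\<lambda>u. ?D (u, ?n u))) (at x)" .
  have low: "((\<lambda>x. (G x *v y) $ k) has_derivative (\<lambda>u. (frechet_derivative G (at x) u *v y) $ k)) (at x)"
    unfolding matrix_vector_mult_def vec_lambda_beta
    by (intro has_derivative_sum has_derivative_mult_left bounded_linear.has_derivative[OF bounded_linear_vec_nth]
        G_has_derivative assms)
  have "partial s (\<lambda>x. X k x y) x = partial s (\<lambda>x. ?H x y * (G x *v y) $ k) x"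
    by (rule partial_cong[OF open_U assms(1)]) (use assms(2) X in auto)
  also have "\<dots> = ?H x y * partial s (\<lambda>x. (G x *v y) $ k) x + partial s (\<lambda>x. ?H x y) x * (G x *v y) $ k"
    unfolding partial_eq[OF h] partial_eq[OF low] by (rule partial_eq[OF has_derivative_mult[OF h low]])
  finally have 1: "partial s (\<lambda>x. X k x y) x =
      ?H x y * partial s (\<lambda>x. (G x *v y) $ k) x + partial s (\<lambda>x. ?H x y) x * (G x *v y) $ k" .
  have v: "vgrad b (X k) x y = vgrad b ?H x y * (G x *v y) $ k + ?H x y * G x $ k $ b" for b
  proof -
    have "vgrad b (X k) x y = d_speed h (x, \<nu> x y) * (G x *v y) $ b * (G x *v y) $ k / \<nu> x y
        + ?H x y * G x $ k $ b"
      by (rule vgrad_spherical_lower[OF assms(1-3)], rule X[OF assms(1)])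
    then show ?thesis unfolding vgrad_spherical[where X = ?H, OF assms(1-3) refl] by simp
  qed
  have 2: "(\<Sum>a\<in>UNIV. \<Sum>b\<in>UNIV. y $ a * \<Gamma> b s a x * vgrad b (X k) x y) =
      (\<Sum>a\<in>UNIV. \<Sum>b\<in>UNIV. y $ a * \<Gamma> b s a x * vgrad b ?H x y) * (G x *v y) $ k
      + ?H x y * (\<Sum>a\<in>UNIV. \<Sum>b\<in>UNIV. y $ a * \<Gamma> b s a x * G x $ k $ b)"
    unfolding v by (simp add: algebra_simps sum.distrib sum_distrib_left sum_distrib_right)
  have 3: "(\<Sum>b\<in>UNIV. \<Gamma> b s k x * X b x y) = ?H x y * (\<Sum>b\<in>UNIV. \<Gamma> b s k x * (G x *v y) $ b)"
    by (simp add: X[OF assms(1,2)] sum_distrib_left mult_ac)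
  \<comment> \<open>All terms with \<open>?H\<close> undifferentiated cancel by
    \<open>partial_lower\<close>; the others assemble to the scalar gradient of
    \<open>?H\<close>.\<close>
  have "sgrad_covec A g c s X k x y = sgrad A g c s ?H x y * (G x *v y) $ k"
    unfolding sgrad_covec_def sgrad_def 1 2 3 partial_lower[OF assms(1)] by (simp add: algebra_simps)
  then show ?thesis unfolding sgrad_spherical[where X = ?H, OF assms(1-3) refl] .
qed

end


section \<open>Symmetry of second derivatives\<close>

lemma has_derivative_along_line:
  fixes f :: "'a::real_normed_vector \<Rightarrow> real"
  assumes "(f has_derivative D) (at (p + s *\<^sub>R u))"
  shows "((\<lambda>s. f (p + s *\<^sub>R u)) has_real_derivative D u) (at s)"
proof -
  have "((\<lambda>s. p + s *\<^sub>R u) has_derivative (\<lambda>r. r *\<^sub>R u)) (at s)"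
    by (auto intro!: derivative_eq_intros)
  from has_derivative_compose[OF this assms]
  have "((\<lambda>s. f (p + s *\<^sub>R u)) has_derivative (\<lambda>r. D (r *\<^sub>R u))) (at s)" .
  moreover have "(\<lambda>r. D (r *\<^sub>R u)) = (*) (D u)"
    using linear_scale[OF has_derivative_linear[OF assms]] by auto
  ultimately show ?thesis by (simp only: has_field_derivative_def)
qed

text \<open>The second difference is the increment, over \<open>s\<close> from 0 to
  \<open>t\<close>, of \<open>f (z + t v + s u) - f (z + s u)\<close>. The mean value theorem in
  \<open>s\<close> and then in the direction \<open>v\<close> turns it into \<open>t^2\<close> times
  an iterated derivative at a point near \<open>z\<close>; continuity of that derivative
  finishes.\<close>

lemma second_difference_limit:
  fixes f :: "'a::euclidean_space \<Rightarrow> real" and u v :: 'a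
  assumes "open S" "smooth_on S f" "z \<in> S"
  defines "fu \<equiv> \<lambda>x. frechet_derivative f (at x) u"
  shows "((\<lambda>t. (f (z + t *\<^sub>R u + t *\<^sub>R v) - f (z + t *\<^sub>R u) - f (z + t *\<^sub>R v) + f z) / t\<^sup>2)
    \<longlongrightarrow> frechet_derivative fu (at z) v) (at_right 0)"
proof (rule tendstoI)
  let ?fuv = "\<lambda>x. frechet_derivative fu (at x) v"
  fix e :: real
  assume "e > 0"
  have fu: "smooth_on S fu" unfolding fu_def by (rule smooth_on_frechet_derivative[OF assms(2)])
  then have "continuous_on S ?fuv"
    by (rule smooth_on_continuous[OF smooth_on_frechet_derivative])
  then have "(?fuv \<longlongrightarrow> ?fuv z) (nhds z)"
    using assms(1,3) by (metis continuous_on_eq_continuous_at isCont_def tendsto_at_iff_tendsto_nhds)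
  then have "\<forall>\<^sub>F x in nhds z. dist (?fuv x) (?fuv z) < e"
    using \<open>e > 0\<close> by (rule tendstoD)
  then have "\<forall>\<^sub>F x in nhds z. x \<in> S \<and> dist (?fuv x) (?fuv z) < e"
    using eventually_nhds_in_open[OF assms(1,3)] by eventually_elim simp
  then obtain d where d: "d > 0" "\<And>x. dist x z < d \<Longrightarrow> x \<in> S \<and> dist (?fuv x) (?fuv z) < e"
    unfolding eventually_nhds_metric by blast
  \<comment> \<open>The summand 1 keeps the bound divisible also when \<open>u\<close> and
    \<open>v\<close> are both zero.\<close>
  have near: "dist (z + s *\<^sub>R u + r *\<^sub>R v) z < d"
    if "0 \<le> s" "s \<le> t" "0 \<le> r" "r \<le> t" "t * (norm u + norm v + 1) < d" for s r t
  proof -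
    have "dist (z + s *\<^sub>R u + r *\<^sub>R v) z \<le> s * norm u + r * norm v"
      using norm_triangle_ineq[of "s *\<^sub>R u" "r *\<^sub>R v"] that by (simp add: dist_norm add.assoc)
    also have "\<dots> \<le> t * norm u + t * norm v"
      using that by (intro add_mono mult_right_mono) auto
    also have "\<dots> \<le> t * (norm u + norm v + 1)"
      using that by (simp add: algebra_simps)
    finally show ?thesis using that by simp
  qed
  have est: "dist ((f (z + t *\<^sub>R u + t *\<^sub>R v) - f (z + t *\<^sub>R u) - f (z + t *\<^sub>R v) + f z) / t\<^sup>2) (?fuv z) < e"
    if t: "0 < t" "t * (norm u + norm v + 1) < d" for t
  proof -
    have 1: "((\<lambda>s. f (z + t *\<^sub>R v + s *\<^sub>R u) - f (z + s *\<^sub>R u)) has_real_derivative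
        fu (z + t *\<^sub>R v + s *\<^sub>R u) - fu (z + s *\<^sub>R u)) (at s)" if "0 \<le> s" "s \<le> t" for s
      unfolding fu_def
      using near[of s t t] near[of s t 0] that t d(2)
      by (intro DERIV_diff has_derivative_along_line smooth_on_has_derivative[OF assms(2)])
         (auto simp: algebra_simps)
    obtain s where s: "0 < s" "s < t"
      "f (z + t *\<^sub>R v + t *\<^sub>R u) - f (z + t *\<^sub>R u) - (f (z + t *\<^sub>R v + 0 *\<^sub>R u) - f (z + 0 *\<^sub>R u)) =
        (t - 0) * (fu (z + t *\<^sub>R v + s *\<^sub>R u) - fu (z + s *\<^sub>R u))"
      using MVT2[OF t(1) 1] by blast
    have 2: "((\<lambda>r. fu (z + s *\<^sub>R u + r *\<^sub>R v)) has_real_derivative ?fuv (z + s *\<^sub>R u + r *\<^sub>R v)) (at r)"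
      if "0 \<le> r" "r \<le> t" for r
      using near[of s t r] that t s d(2)
      by (intro has_derivative_along_line smooth_on_has_derivative[OF fu]) auto
    obtain r where r: "0 < r" "r < t"
      "fu (z + s *\<^sub>R u + t *\<^sub>R v) - fu (z + s *\<^sub>R u + 0 *\<^sub>R v) = (t - 0) * ?fuv (z + s *\<^sub>R u + r *\<^sub>R v)"
      using MVT2[OF t(1) 2] by blast
    have "f (z + t *\<^sub>R u + t *\<^sub>R v) - f (z + t *\<^sub>R u) - f (z + t *\<^sub>R v) + f z =
        t\<^sup>2 * ?fuv (z + s *\<^sub>R u + r *\<^sub>R v)"
      using s(3) r(3) by (simp add: power2_eq_square add_ac)
    then show ?thesis using near[of s t r] s r t d(2) by simp
  qed
  have "\<forall>\<^sub>F t in at_right 0. t < d / (norm u + norm v + 1)"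
    by (rule eventually_at_rightI[of 0 "d / (norm u + norm v + 1)"])
       (use d(1) in \<open>auto intro!: divide_pos_pos add_nonneg_pos\<close>)
  moreover have "\<forall>\<^sub>F t in at_right (0::real). 0 < t" by (rule eventually_at_right_less)
  ultimately show "\<forall>\<^sub>F t in at_right 0. dist
      ((f (z + t *\<^sub>R u + t *\<^sub>R v) - f (z + t *\<^sub>R u) - f (z + t *\<^sub>R v) + f z) / t\<^sup>2) (?fuv z) < e"
  proof eventually_elim
    case (elim t)
    have "norm u + norm v + 1 > 0" by (intro add_nonneg_pos) auto
    then show ?case using elim by (intro est) (auto simp: field_simps)
  qed
qed

text \<open>The second difference is symmetric in \<open>u\<close> and \<open>v\<close>, so both
  sides are limits of the same quotient.\<close>

lemma frechet_derivative_commute: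
  fixes f :: "'a::euclidean_space \<Rightarrow> real"
  assumes "open S" "smooth_on S f" "z \<in> S"
  shows "frechet_derivative (\<lambda>x. frechet_derivative f (at x) u) (at z) v =
    frechet_derivative (\<lambda>x. frechet_derivative f (at x) v) (at z) u"
  using second_difference_limit[OF assms, of u v] second_difference_limit[OF assms, of v u]
  by (intro tendsto_unique[OF trivial_limit_at_right_real]) (simp_all add: algebra_simps)


section \<open>Smoothness of spherically symmetric fields\<close>

lemma smooth_on_space_section:
  assumes "smooth_on (S \<times> {0<..}) h" "x \<in> S" "t > (0::real)"
  shows "((\<lambda>x. h (x, t)) has_derivative (\<lambda>u. frechet_derivative h (at (x, t)) (u, 0))) (at x)"
proof -
  have h: "(h has_derivative frechet_derivative h (at (x, t))) (at (x, t))"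
    using assms by (auto intro: smooth_on_has_derivative)
  have "((\<lambda>x. (x, t)) has_derivative (\<lambda>u. (u, 0))) (at x)"
    by (auto intro!: derivative_eq_intros)
  from has_derivative_compose[OF this h] show ?thesis .
qed

text \<open>The bound on the dimension acts through this vector: it separates the direction of the
  velocity from a fixed covector, and it detects a degenerate Hessian.\<close>

lemma orthogonal_nonzero_vector:
  fixes a :: "real ^ 'n::finite"
  assumes "CARD('n) \<ge> 2"
  obtains y where "y \<noteq> 0" "a \<bullet> y = 0"
  using orthogonal_to_vector_exists[of a] assms by (auto simp: orthogonal_def)

context riemannian_chart
begin

abbreviation profile :: "('m \<Rightarrow> real \<Rightarrow> real) \<Rightarrow> (real ^ 'n) \<times> real \<Rightarrow> real" where
  "profile w \<equiv> \<lambda>z. w (pt c (fst z)) (snd z)"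

lemma loc_spherical: "loc A c (spherical g w) x y = profile w (x, \<nu> x y)"
  by (simp add: loc_def spherical_def)

lemma open_dom: "open (U \<times> (UNIV - {0::real^'n}))" "open (U \<times> {0::real<..})"
  using open_U by (auto intro!: open_Times)

lemma \<nu>_smooth: "smooth_on (U \<times> (UNIV - {0})) (\<lambda>z. \<nu> (fst z) (snd z))"
proof (rule smooth_on_cong[OF open_dom(1)])
  have G: "smooth_on (U \<times> (UNIV - {0::real^'n})) (\<lambda>z. G (fst z))"
    by (rule smooth_on_comp[OF open_dom(1) open_U _ G_smooth])
       (auto intro: smooth_on_linear open_dom bounded_linear_fst)
  have Gij: "smooth_on (U \<times> (UNIV - {0::real^'n})) (\<lambda>z. G (fst z) $ i $ j)" for i j
    by (rule smooth_on_linear_comp[OF open_dom(1) bounded_linear_compose[OF bounded_linear_vec_nth bounded_linear_vec_nth] G])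
  have y: "smooth_on (U \<times> (UNIV - {0::real^'n})) (\<lambda>z. snd z $ i)" for i
    by (intro smooth_on_linear open_dom bounded_linear_compose[OF bounded_linear_vec_nth bounded_linear_snd])
  have "smooth_on (U \<times> (UNIV - {0})) (\<lambda>z. snd z \<bullet> (G (fst z) *v snd z))"
    unfolding inner_vec_def matrix_vector_mult_def vec_lambda_beta inner_real_def
    by (intro smooth_on_sum smooth_on_mult open_dom Gij y finite)
  then show "smooth_on (U \<times> (UNIV - {0})) (\<lambda>z. sqrt (snd z \<bullet> (G (fst z) *v snd z)))"
    by (rule smooth_on_sqrt[OF open_dom(1)]) (auto intro: G_pos)
qed (auto simp: \<nu>_eq)

lemma spherical_smooth:
  assumes "smooth_on (U \<times> {0<..}) (profile w)"
  shows "smooth_on (U \<times> (UNIV - {0})) (\<lambda>(x, y). loc A c (spherical g w) x y)"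
proof -
  have fst: "smooth_on (U \<times> (UNIV - {0::real^'n})) fst"
    by (intro smooth_on_linear open_dom bounded_linear_fst)
  have "smooth_on (U \<times> (UNIV - {0})) (\<lambda>z. profile w (fst z, \<nu> (fst z) (snd z)))"
    by (rule smooth_on_comp[OF open_dom _ assms smooth_on_Pair[OF open_dom(1) fst \<nu>_smooth]])
       (auto intro!: \<nu>_pos)
  then show ?thesis by (simp add: loc_spherical split_def)
qed

text \<open>Restrict the extended field to a ray: the multiple \<open>t / \<nu> x e\<close> of a
  fixed nonzero vector \<open>e\<close> has speed exactly \<open>t\<close> and depends smoothly on
  \<open>(x, t)\<close>.\<close>

lemma profile_smooth:
  assumes "extended_scalar_field A (spherical g w)"
  shows "smooth_on (U \<times> {0<..}) (profile w)"
proof -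
  let ?e = "axis undefined 1 :: real^'n"
  have e: "?e \<noteq> 0" by simp
  have X: "smooth_on (U \<times> (UNIV - {0})) (\<lambda>z. profile w (fst z, \<nu> (fst z) (snd z)))"
  proof -
    have "smooth_on (U \<times> (UNIV - {0})) (\<lambda>z. loc A c (spherical g w) (fst z) (snd z))"
      using assms chart by (auto simp: extended_scalar_field_def split_def)
    then show ?thesis by (simp add: loc_spherical)
  qed
  have fst: "smooth_on (U \<times> {0::real<..}) fst"
    by (intro smooth_on_linear open_dom bounded_linear_fst)
  have snd: "smooth_on (U \<times> {0::real<..}) snd"
    by (intro smooth_on_linear open_dom bounded_linear_snd)
  have "smooth_on (U \<times> {0<..}) (\<lambda>z::(real^'n) \<times> real. \<nu> (fst (fst z, ?e)) (snd (fst z, ?e)))"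
    by (rule smooth_on_comp[OF open_dom(2,1) _ \<nu>_smooth smooth_on_Pair[OF open_dom(2) fst smooth_on_const[OF open_dom(2)]]])
       (use e in auto)
  then have "smooth_on (U \<times> {0<..}) (\<lambda>z::(real^'n) \<times> real. \<nu> (fst z) ?e)" by simp
  then have "smooth_on (U \<times> {0<..}) (\<lambda>z. (fst z, (snd z / \<nu> (fst z) ?e) *\<^sub>R ?e))"
    by (intro smooth_on_Pair smooth_on_scaleR smooth_on_divide smooth_on_const open_dom fst snd)
       (use \<nu>_pos[OF _ e] in force)+
  from smooth_on_comp[OF open_dom(2,1) _ X this]
  have "smooth_on (U \<times> {0<..}) (\<lambda>z. profile w (fst z, \<nu> (fst z) ((snd z / \<nu> (fst z) ?e) *\<^sub>R ?e)))"
    using \<nu>_pos[OF _ e] e by fastforce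
  then show ?thesis
  proof (rule smooth_on_cong[OF open_dom(2)])
    fix z :: "(real^'n) \<times> real"
    assume "z \<in> U \<times> {0<..}"
    then have "\<nu> (fst z) ((snd z / \<nu> (fst z) ?e) *\<^sub>R ?e) = snd z"
      using \<nu>_pos[OF _ e, of "fst z"] by (auto simp: \<nu>_scale)
    then show "profile w (fst z, \<nu> (fst z) ((snd z / \<nu> (fst z) ?e) *\<^sub>R ?e)) = profile w z"
      by simp
  qed
qed

lemma deriv_profile:
  assumes "smooth_on (U \<times> {0<..}) (profile w)" "x \<in> U" "t > 0"
  shows "deriv (w (pt c x)) t = d_speed (profile w) (x, t)"
  using smooth_on_speed_section[OF assms] by (auto intro: DERIV_imp_deriv)


section \<open>The Euler--Lagrange equations\<close>

abbreviation momentum :: "('m \<Rightarrow> real \<Rightarrow> real) \<Rightarrow> (real ^ 'n) \<times> real \<Rightarrow> real" where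
  "momentum l \<equiv> \<lambda>z. d_speed (profile l) z / snd z"

lemma momentum_smooth:
  assumes "smooth_on (U \<times> {0<..}) (profile l)"
  shows "smooth_on (U \<times> {0<..}) (momentum l)"
  by (intro smooth_on_divide smooth_on_frechet_derivative[OF assms] smooth_on_linear open_dom
      bounded_linear_snd) auto

lemma
  assumes l: "smooth_on (U \<times> {0<..}) (profile l)" and "x \<in> U" "y \<noteq> 0"
  shows vgrad_loc: "vgrad j (loc A c (spherical g l)) x y = momentum l (x, \<nu> x y) * (G x *v y) $ j"
    and sgrad_loc: "sgrad A g c q (loc A c (spherical g l)) x y = d_space q (profile l) (x, \<nu> x y)"
proof -
  have d: "profile l differentiable (at (x, \<nu> x y))"
    using assms \<nu>_pos by (intro smooth_on_differentiable[OF l]) auto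
  show "vgrad j (loc A c (spherical g l)) x y = momentum l (x, \<nu> x y) * (G x *v y) $ j"
    using vgrad_spherical[OF assms(2,3) d] loc_spherical by simp
  show "sgrad A g c q (loc A c (spherical g l)) x y = d_space q (profile l) (x, \<nu> x y)"
    using sgrad_spherical[OF assms(2,3) d] loc_spherical by simp
qed

text \<open>The velocity gradient of the Lagrangian is a radial factor, the momentum, times the
  lowered velocity. The general rules for such products therefore apply a second time.\<close>

lemma
  assumes l: "smooth_on (U \<times> {0<..}) (profile l)" and "x \<in> U" "y \<noteq> 0"
  shows hessian_loc: "vgrad i (vgrad j (loc A c (spherical g l))) x y =
      d_speed (momentum l) (x, \<nu> x y) * (G x *v y) $ i * (G x *v y) $ j / \<nu> x y
      + momentum l (x, \<nu> x y) * G x $ j $ i"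
    and sgrad_covec_loc: "sgrad_covec A g c q (\<lambda>k. vgrad k (loc A c (spherical g l))) k x y =
      d_space q (momentum l) (x, \<nu> x y) * (G x *v y) $ k"
proof -
  have d: "momentum l differentiable (at (x, \<nu> x y))"
    using assms \<nu>_pos by (intro smooth_on_differentiable[OF momentum_smooth[OF l]]) auto
  show "vgrad i (vgrad j (loc A c (spherical g l))) x y =
      d_speed (momentum l) (x, \<nu> x y) * (G x *v y) $ i * (G x *v y) $ j / \<nu> x y
      + momentum l (x, \<nu> x y) * G x $ j $ i"
    by (rule vgrad_spherical_lower[OF assms(2,3) d]) (rule vgrad_loc[OF l assms(2)])
  show "sgrad_covec A g c q (\<lambda>k. vgrad k (loc A c (spherical g l))) k x y =
      d_space q (momentum l) (x, \<nu> x y) * (G x *v y) $ k"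
    by (rule sgrad_covec_spherical_lower[OF assms(2,3) d]) (rule vgrad_loc[OF l])
qed

text \<open>The force is left as an arbitrary vector \<open>\<phi>\<close>, because both directions
  of the theorem evaluate this expression.\<close>

lemma euler_lagrange_loc:
  assumes l: "smooth_on (U \<times> {0<..}) (profile l)" and "x \<in> U" "y \<noteq> 0"
  defines "L \<equiv> loc A c (spherical g l)"
  shows "(\<Sum>s\<in>UNIV. vgrad s (vgrad k L) x y * \<phi> $ s)
      + (\<Sum>s\<in>UNIV. sgrad_covec A g c s (\<lambda>k. vgrad k L) k x y * y $ s) - sgrad A g c k L x y =
    (d_speed (momentum l) (x, \<nu> x y) * (y \<bullet> (G x *v \<phi>)) / \<nu> x y
      + (\<Sum>s\<in>UNIV. d_space s (momentum l) (x, \<nu> x y) * y $ s)) * (G x *v y) $ k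
    + momentum l (x, \<nu> x y) * (G x *v \<phi>) $ k - d_space k (profile l) (x, \<nu> x y)"
proof -
  let ?dm = "d_speed (momentum l) (x, \<nu> x y)"
  have "(\<Sum>s\<in>UNIV. vgrad s (vgrad k L) x y * \<phi> $ s) =
      ?dm / \<nu> x y * (G x *v y) $ k * (\<Sum>s\<in>UNIV. \<phi> $ s * (G x *v y) $ s)
      + momentum l (x, \<nu> x y) * (\<Sum>s\<in>UNIV. G x $ k $ s * \<phi> $ s)"
    unfolding L_def hessian_loc[OF assms(1-3)] sum_distrib_left sum.distrib[symmetric]
    by (intro sum.cong refl) (simp add: algebra_simps)
  also have "(\<Sum>s\<in>UNIV. \<phi> $ s * (G x *v y) $ s) = y \<bullet> (G x *v \<phi>)"
    by (subst inner_G_sym[OF assms(2)]) (simp add: inner_vec_def)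
  also have "(\<Sum>s\<in>UNIV. G x $ k $ s * \<phi> $ s) = (G x *v \<phi>) $ k"
    by (simp add: matrix_vector_mult_def)
  finally have 1: "(\<Sum>s\<in>UNIV. vgrad s (vgrad k L) x y * \<phi> $ s) =
      ?dm / \<nu> x y * (G x *v y) $ k * (y \<bullet> (G x *v \<phi>)) + momentum l (x, \<nu> x y) * (G x *v \<phi>) $ k" .
  have 2: "(\<Sum>s\<in>UNIV. sgrad_covec A g c s (\<lambda>k. vgrad k L) k x y * y $ s) =
      (\<Sum>s\<in>UNIV. d_space s (momentum l) (x, \<nu> x y) * y $ s) * (G x *v y) $ k"
    unfolding L_def sgrad_covec_loc[OF assms(1-3)] sum_distrib_right
    by (intro sum.cong refl) simp
  show ?thesis unfolding 1 2 unfolding L_def sgrad_loc[OF assms(1-3)] by (simp add: algebra_simps)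
qed

end


lemma det_nz_iff_ker:
  fixes M :: "real ^ 'n ^ 'n"
  shows "det M \<noteq> 0 \<longleftrightarrow> (\<forall>z. M *v z = 0 \<longrightarrow> z = 0)"
  using invertible_det_nz invertible_left_inverse matrix_left_invertible_ker by metis

lemma rank_one_matrix_mult:
  fixes v z :: "real ^ 'n::finite"
  shows "(\<chi> i j. a * v $ i * v $ j / b) *v z = (a * (v \<bullet> z) / b) *\<^sub>R v"
  by (simp add: vec_eq_iff matrix_vector_mult_def inner_vec_def sum_distrib_left sum_distrib_right
      sum_divide_distrib mult_ac)

lemma frechet_derivative_space_sum:
  fixes h :: "(real ^ 'n::finite) \<times> real \<Rightarrow> real"
  assumes "h differentiable (at z)"
  shows "frechet_derivative h (at z) (u, 0) = (\<Sum>q\<in>UNIV. u $ q * d_space q h z)"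
proof -
  let ?D = "frechet_derivative h (at z)"
  have lin: "linear (\<lambda>u. ?D (u, 0))"
    by (rule linear_compose[OF linearI linear_frechet_derivative[OF assms], unfolded o_def]) auto
  have "?D (u, 0) = ?D ((\<Sum>i\<in>UNIV. (u $ i) *\<^sub>R axis i 1), 0)"
    using vec_basis_sum[of u] by simp
  also have "\<dots> = (\<Sum>q\<in>UNIV. u $ q * d_space q h z)"
    unfolding linear_sum[OF lin] linear_scale[OF lin] real_scaleR_def ..
  finally show ?thesis .
qed

text \<open>By the mean value theorem equal values would force a zero of the derivative; its sign
  need not be known.\<close>

lemma inj_on_pos_if_deriv_nonzero:
  fixes \<phi> :: "real \<Rightarrow> real"
  assumes "\<And>t. t > 0 \<Longrightarrow> (\<phi> has_real_derivative \<phi>' t) (at t)" "\<And>t. t > 0 \<Longrightarrow> \<phi>' t \<noteq> 0"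
  shows "inj_on \<phi> {0<..}"
proof -
  have "\<phi> a \<noteq> \<phi> b" if ab: "0 < a" "a < b" for a b
  proof -
    have "(\<phi> has_real_derivative \<phi>' t) (at t)" if "a \<le> t" "t \<le> b" for t
      using that ab by (intro assms) auto
    from MVT2[OF ab(2) this] obtain z where "a < z" "\<phi> b - \<phi> a = (b - a) * \<phi>' z" by blast
    then show ?thesis using assms(2)[of z] ab by auto
  qed
  then show ?thesis by (intro linorder_inj_onI') (metis greaterThan_iff)
qed

context riemannian_chart
begin

text \<open>By implicit differentiation, a level set \<open>t = t(x)\<close> of the profile
  satisfies \<open>dt/dx^q = - slope w (x, t) $ q\<close>.\<close>

abbreviation slope :: "('m \<Rightarrow> real \<Rightarrow> real) \<Rightarrow> (real ^ 'n) \<times> real \<Rightarrow> real ^ 'n" where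
  "slope w \<equiv> \<lambda>z. \<chi> q. d_space q (profile w) z / d_speed (profile w) z"

text \<open>In this form the force depends on \<open>w\<close> only through its slope, and the slope
  \<open>- \<nu> d\<close> reproduces the expression in \<open>f_force_loc\<close>.\<close>

lemma W_force_loc:
  assumes w: "smooth_on (U \<times> {0<..}) (profile w)" and "x \<in> U" "y \<noteq> 0"
  defines "b \<equiv> slope w (x, \<nu> x y)"
  shows "W_force A g w c r x y = \<nu> x y * b $ r - 2 * (b \<bullet> y) / \<nu> x y * (G x *v y) $ r"
proof -
  have pos: "\<nu> x y > 0" by (rule \<nu>_pos[OF assms(2,3)])
  have "W_force A g w c r x y =
      - \<nu> x y * (\<Sum>s\<in>UNIV. b $ s * (2 * y $ s * (G x *v y) $ r / (\<nu> x y)\<^sup>2 - (if s = r then 1 else 0)))"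
    unfolding W_force_def Let_def sgrad_loc[OF assms(1-3)] deriv_profile[OF w assms(2) pos] lower_eq
    by (simp add: b_def)
  also have "(\<Sum>s\<in>UNIV. b $ s * (2 * y $ s * (G x *v y) $ r / (\<nu> x y)\<^sup>2 - (if s = r then 1 else 0))) =
      (\<Sum>s\<in>UNIV. b $ s * y $ s) * (2 * (G x *v y) $ r / (\<nu> x y)\<^sup>2) - (\<Sum>s\<in>UNIV. if s = r then b $ s else 0)"
    unfolding sum_distrib_right sum_subtractf[symmetric] by (intro sum.cong refl) (simp add: right_diff_distrib)
  also have "\<dots> = (b \<bullet> y) * (2 * (G x *v y) $ r / (\<nu> x y)\<^sup>2) - b $ r"
    by (simp add: inner_vec_def)
  also have "- \<nu> x y * ((b \<bullet> y) * (2 * (G x *v y) $ r / (\<nu> x y)\<^sup>2) - b $ r) =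
      \<nu> x y * b $ r - 2 * (b \<bullet> y) / \<nu> x y * (G x *v y) $ r"
    using pos by (simp add: field_simps power2_eq_square)
  finally show ?thesis .
qed

lemma f_force_loc:
  fixes f :: "'m \<Rightarrow> real"
  assumes "x \<in> U"
  defines "d \<equiv> \<chi> q. partial q (\<lambda>x. f (pt c x)) x"
  shows "f_force A g f c r x y = 2 * (d \<bullet> y) * (G x *v y) $ r - (\<nu> x y)\<^sup>2 * d $ r"
proof -
  have "sgrad A g c q (loc A c (\<lambda>p v. f p)) x y = d $ q" for q
    by (simp add: sgrad_def loc_def vgrad_def partial_def d_def)
  then show ?thesis by (simp add: f_force_def Let_def lower_eq inner_vec_def)
qed

text \<open>The relation holds in every direction at one fixed speed, so two well-chosen directions
  suffice; any nonzero vector can be rescaled to speed \<open>t\<close>.\<close>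

lemma isotropic_relation_trivial:
  assumes "CARD('n) \<ge> 2" "x \<in> U" "t > 0"
    and eq: "\<And>y. y \<noteq> 0 \<Longrightarrow> \<nu> x y = t \<Longrightarrow> (p \<bullet> y) *\<^sub>R (G x *v y) + q = 0"
  shows "p = 0 \<and> q = 0"
proof
  have scaled: "(t / \<nu> x y) *\<^sub>R y \<noteq> 0 \<and> \<nu> x ((t / \<nu> x y) *\<^sub>R y) = t" if "y \<noteq> 0" for y
    using \<nu>_pos[OF assms(2) that] assms(2,3) that by (simp add: \<nu>_scale)
  show "q = 0"
  proof -
    \<comment> \<open>For this \<open>y\<close>, \<open>q\<close> is orthogonal to
      \<open>G y\<close> by symmetry of the metric, while the relation makes \<open>q\<close> a
      multiple of \<open>G y\<close>. Hence \<open>q\<close> is orthogonal to itself.\<close>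
    obtain y where y: "y \<noteq> 0" "(G x *v q) \<bullet> y = 0" by (rule orthogonal_nonzero_vector[OF assms(1)])
    let ?y = "(t / \<nu> x y) *\<^sub>R y"
    have "q \<bullet> (G x *v ?y) = 0"
      using y(2) inner_G_sym[OF assms(2), of q ?y] by (simp add: inner_commute)
    moreover have "q = - ((p \<bullet> ?y) *\<^sub>R (G x *v ?y))"
      using eq[of ?y] scaled[OF y(1)] by (simp add: eq_neg_iff_add_eq_0 add.commute)
    ultimately have "q \<bullet> q = 0"
      using arg_cong[of q _ "\<lambda>v. q \<bullet> v"] by (simp only: inner_minus_right inner_scaleR_right mult_zero_right minus_zero)
    then show ?thesis by simp
  qed
  show "p = 0"
  proof (rule ccontr)
    assume p: "p \<noteq> 0"
    \<comment> \<open>Along \<open>p\<close> itself the scalar factor is nonzero.\<close>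
    let ?y = "(t / \<nu> x p) *\<^sub>R p"
    have "(p \<bullet> ?y) *\<^sub>R (G x *v ?y) = 0" using eq[of ?y] scaled[OF p] \<open>q = 0\<close> by simp
    moreover have "G x *v ?y \<noteq> 0" using G_pos[OF assms(2), of ?y] scaled[OF p] by auto
    moreover have "p \<bullet> ?y \<noteq> 0" using p scaled[OF p] by auto
    ultimately show False by simp
  qed
qed

text \<open>With vanishing momentum the Hessian reduces to a rank-one matrix, which kills every
  vector orthogonal to the lowered velocity.\<close>

lemma momentum_nonzero:
  assumes "CARD('n) \<ge> 2" and l: "smooth_on (U \<times> {0<..}) (profile l)" and "x \<in> U" "y \<noteq> 0"
    and "det ((\<chi> i j. vgrad i (vgrad j (loc A c (spherical g l))) x y) :: real ^ 'n ^ 'n) \<noteq> 0"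
  shows "momentum l (x, \<nu> x y) \<noteq> 0"
proof
  assume 0: "momentum l (x, \<nu> x y) = 0"
  obtain z where z: "z \<noteq> 0" "(G x *v y) \<bullet> z = 0" by (rule orthogonal_nonzero_vector[OF assms(1)])
  have "(\<chi> i j. vgrad i (vgrad j (loc A c (spherical g l))) x y) *v z =
      (d_speed (momentum l) (x, \<nu> x y) * ((G x *v y) \<bullet> z) / \<nu> x y) *\<^sub>R (G x *v y)"
    unfolding hessian_loc[OF l assms(3,4)] 0 rank_one_matrix_mult[symmetric] by simp
  also have "\<dots> = 0" using z(2) by simp
  finally show False using assms(5) z(1) unfolding det_nz_iff_ker by blast
qed

text \<open>At fixed \<open>x\<close> and \<open>t\<close> the derivatives of \<open>l\<close> and
  \<open>w\<close> do not see the direction of \<open>y\<close>. The Euler-Lagrange equations thus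
  take the form of \<open>isotropic_relation_trivial\<close>, with \<open>p\<close> from the terms
  along the lowered velocity and \<open>q\<close> from the rest.\<close>

lemma lagrangian_equations:
  assumes "CARD('n) \<ge> 2"
    and w: "smooth_on (U \<times> {0<..}) (profile w)" and l: "smooth_on (U \<times> {0<..}) (profile l)"
    and F: "has_covariant_components A g F (W_force A g w)"
    and L: "has_lagrangian A g F (spherical g l)"
    and "x \<in> U" "t > 0"
  defines "b \<equiv> slope w (x, t)"
  shows "momentum l (x, t) \<noteq> 0"
    and "d_space k (profile l) (x, t) = t * momentum l (x, t) * b $ k"
    and "d_space k (momentum l) (x, t) =
      d_speed (momentum l) (x, t) * b $ k + 2 * momentum l (x, t) * b $ k / t"
proof -
  let ?m = "momentum l (x, t)" and ?dm = "d_speed (momentum l) (x, t)"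
  define a where "a = (\<chi> s. d_space s (momentum l) (x, t))"
  define e where "e = (\<chi> s. d_space s (profile l) (x, t))"
  have "((a - ?dm *\<^sub>R b - (2 * ?m / t) *\<^sub>R b) \<bullet> y) *\<^sub>R (G x *v y) + ((t * ?m) *\<^sub>R b - e) = 0"
    if y: "y \<noteq> 0" "\<nu> x y = t" for y
  proof -
    let ?\<phi> = "loc_vec A c F x y"
    have "lower A g c x ?\<phi> r = W_force A g w c r x y" for r
      using F chart assms(6) y(1) unfolding has_covariant_components_def by blast
    then have G\<phi>: "G x *v ?\<phi> = t *\<^sub>R b - (2 * (b \<bullet> y) / t) *\<^sub>R (G x *v y)"
      unfolding lower_eq W_force_loc[OF w assms(6) y(1)] y(2) b_def[symmetric] vec_eq_iff by simp
    have y2: "y \<bullet> (G x *v y) = t\<^sup>2" using \<nu>_sq[OF assms(6), of y] y(2) by simp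
    \<comment> \<open>The first term of the force contributes \<open>t (b \<bullet> y)\<close>, the
      second \<open>- 2 t (b \<bullet> y)\<close>, since \<open>y\<close> has squared length
      \<open>t^2\<close>.\<close>
    have yG: "y \<bullet> (G x *v ?\<phi>) = - t * (b \<bullet> y)"
      unfolding G\<phi> using assms(7) y2
      by (simp add: inner_diff_right inner_commute power2_eq_square)
    have "(?dm * (y \<bullet> (G x *v ?\<phi>)) / t + (a \<bullet> y)) * (G x *v y) $ k + ?m * (G x *v ?\<phi>) $ k - e $ k = 0" for k
      using L chart assms(6) y(1) euler_lagrange_loc[OF l assms(6) y(1), of k ?\<phi>]
      unfolding has_lagrangian_def Let_def y(2) a_def e_def inner_vec_def by simp
    then have "(a \<bullet> y - ?dm * (b \<bullet> y) - 2 * ?m / t * (b \<bullet> y)) * (G x *v y) $ k + (t * ?m * b $ k - e $ k) = 0" for k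
      unfolding yG unfolding G\<phi> using assms(7) by (simp add: algebra_simps)
    then show ?thesis
      by (simp add: vec_eq_iff inner_diff_left)
  qed
  from isotropic_relation_trivial[OF assms(1,6,7) this]
  have pq: "a - ?dm *\<^sub>R b - (2 * ?m / t) *\<^sub>R b = 0" "(t * ?m) *\<^sub>R b - e = 0" by auto
  show "d_space k (profile l) (x, t) = t * ?m * b $ k"
    using pq(2) by (simp add: vec_eq_iff e_def)
  show "d_space k (momentum l) (x, t) = ?dm * b $ k + 2 * ?m * b $ k / t"
    using pq(1) by (simp add: vec_eq_iff a_def algebra_simps)
  \<comment> \<open>Regularity speaks of velocities, not speeds, so some velocity of speed
    \<open>t\<close> must be exhibited.\<close>
  define y :: "real^'n" where "y = (t / \<nu> x (axis undefined 1)) *\<^sub>R axis undefined 1"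
  have "\<nu> x (axis undefined 1) > 0" by (rule \<nu>_pos[OF assms(6)]) simp
  then have y: "y \<noteq> 0" "\<nu> x y = t"
    using assms(7) by (auto simp: y_def \<nu>_scale[OF assms(6)])
  show "?m \<noteq> 0"
  proof -
    have "det ((\<chi> i j. vgrad i (vgrad j (loc A c (spherical g l))) x y) :: real ^ 'n ^ 'n) \<noteq> 0"
      using L chart assms(6) y(1) unfolding has_lagrangian_def Let_def by blast
    from momentum_nonzero[OF assms(1) l assms(6) y(1) this] show ?thesis unfolding y(2) .
  qed
qed

text \<open>The two first-order equations for the Lagrangian are compatible only if the slope is
  homogeneous of degree one in the speed: differentiate the first one in the speed and compare.\<close>

lemma slope_linear:
  assumes "CARD('n) \<ge> 2"
    and w: "smooth_on (U \<times> {0<..}) (profile w)" and l: "smooth_on (U \<times> {0<..}) (profile l)"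
    and w': "\<And>x t. x \<in> U \<Longrightarrow> t > 0 \<Longrightarrow> d_speed (profile w) (x, t) \<noteq> 0"
    and F: "has_covariant_components A g F (W_force A g w)"
    and L: "has_lagrangian A g F (spherical g l)"
    and x: "x \<in> U" and "t > 0"
  shows "slope w (x, t) = t *\<^sub>R slope w (x, 1)"
proof -
  note eqs = lagrangian_equations[OF assms(1) w l F L x]
  have "slope w (x, t) $ k = t * slope w (x, 1) $ k" for k
  proof -
    define b where "b = (\<lambda>z. d_space k (profile w) z / d_speed (profile w) z)"
    \<comment> \<open>\<open>d\<close> is \<open>l'\<close>, that is, \<open>t\<close> times the
      momentum; the first-order equation for \<open>l\<close> then reads \<open>d * b\<close>
      without a power of \<open>t\<close>.\<close>
    define d where "d = d_speed (profile l)"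
    have bs: "smooth_on (U \<times> {0<..}) b"
      unfolding b_def using w' by (intro smooth_on_divide smooth_on_frechet_derivative w open_dom) auto
    have ds: "smooth_on (U \<times> {0<..}) d"
      unfolding d_def by (intro smooth_on_frechet_derivative l)
    have zero: "((\<lambda>t. b (x, t) / t) has_real_derivative 0) (at t)" if t: "t > 0" for t
    proof -
      note Db = smooth_on_speed_section[OF bs x t] and Dd = smooth_on_speed_section[OF ds x t]
      have "((\<lambda>t. d_space k (profile l) (x, t)) has_real_derivative
          d_speed (d_space k (profile l)) (x, t)) (at t)"
        by (rule smooth_on_speed_section[OF smooth_on_frechet_derivative[OF l] x t])
      moreover have "((\<lambda>t. d_space k (profile l) (x, t)) has_real_derivative
          d (x, t) * d_speed b (x, t) + d_speed d (x, t) * b (x, t)) (at t)"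
      proof (rule has_field_derivative_transform_within_open[OF DERIV_mult'[OF Dd Db]])
        show "d (x, s) * b (x, s) = d_space k (profile l) (x, s)" if "s \<in> {0<..}" for s
          using eqs(2)[of s k] that by (simp add: d_def b_def)
      qed (use t in auto)
      ultimately have "d_speed (d_space k (profile l)) (x, t) =
          d (x, t) * d_speed b (x, t) + d_speed d (x, t) * b (x, t)"
        by (rule DERIV_unique)
      \<comment> \<open>Commuting the mixed derivatives turns the left side into the spatial
        derivative of \<open>l'\<close>, which the equation for the momentum determines as
        well.\<close>
      moreover have "d_speed (d_space k (profile l)) (x, t) = d_space k d (x, t)"
        unfolding d_def by (rule frechet_derivative_commute[OF open_dom(2) l]) (use x t in auto)
      moreover have "d_space k (momentum l) (x, t) = d_space k d (x, t) / t"
      proof -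
        have 1: "((\<lambda>x. d (x, t) / t) has_derivative (\<lambda>u. frechet_derivative d (at (x, t)) (u, 0) / t)) (at x)"
          using bounded_linear.has_derivative[OF bounded_linear_divide smooth_on_space_section[OF ds x t]] .
        have 2: "((\<lambda>x. d (x, t) / t) has_derivative (\<lambda>u. frechet_derivative (momentum l) (at (x, t)) (u, 0))) (at x)"
          using smooth_on_space_section[OF momentum_smooth[OF l] x t] by (simp add: d_def)
        show ?thesis using fun_cong[OF has_derivative_unique[OF 1 2], of "axis k 1"] by simp
      qed
      moreover have "d_speed (momentum l) (x, t) = d_speed d (x, t) / t - d (x, t) / t\<^sup>2"
      proof -
        have "((\<lambda>t. d (x, t) / t) has_real_derivative d_speed d (x, t) / t - d (x, t) / t\<^sup>2) (at t)"
          using DERIV_divide[OF Dd DERIV_ident] t by (simp add: field_simps power2_eq_square)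
        moreover have "((\<lambda>t. d (x, t) / t) has_real_derivative d_speed (momentum l) (x, t)) (at t)"
          using smooth_on_speed_section[OF momentum_smooth[OF l] x t] by (simp add: d_def)
        ultimately show ?thesis using DERIV_unique by blast
      qed
      ultimately have "(d (x, t) * d_speed b (x, t) + d_speed d (x, t) * b (x, t)) / t =
          (d_speed d (x, t) / t - d (x, t) / t\<^sup>2) * b (x, t) + 2 * (d (x, t) / t) * b (x, t) / t"
        using eqs(3)[OF t, of k] by (simp add: b_def d_def)
      \<comment> \<open>The terms with the speed derivative of \<open>d\<close> cancel. What
        remains, after division by \<open>d\<close>, is Euler's equation \<open>t b' = b\<close> for
        homogeneity of degree one.\<close>
      then have "d (x, t) * (t * d_speed b (x, t)) = d (x, t) * b (x, t)"
        using t by (simp add: field_simps power2_eq_square)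
      moreover have "d (x, t) \<noteq> 0" using eqs(1)[OF t] by (simp add: d_def)
      ultimately have "t * d_speed b (x, t) = b (x, t)" by simp
      then show ?thesis
        using DERIV_divide[OF Db DERIV_ident] t by (simp add: mult.commute)
    qed
    have "\<exists>a. \<forall>t\<in>{0<..}. b (x, t) / t = a"
      by (rule has_field_derivative_zero_constant) (auto intro: has_field_derivative_at_within zero)
    then have "b (x, t) / t = b (x, 1) / 1" using assms(8) by (metis greaterThan_iff zero_less_one)
    then have "b (x, t) = t * b (x, 1)" using assms(8) by (simp add: field_simps)
    then show ?thesis by (simp add: b_def)
  qed
  then show ?thesis by (simp add: vec_eq_iff)
qed

end


section \<open>The potential\<close>

text \<open>The level set through a value \<open>a\<close> of \<open>w\<close> is a graph over each component on which \<open>a\<close> is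
  attained; the range of \<open>w p\<close> is locally constant, hence so is the choice below.\<close>

definition level_speed :: "('m \<Rightarrow> real \<Rightarrow> real) \<Rightarrow> 'm \<Rightarrow> real" where
  "level_speed w p = inv_into {0<..} (w p) (SOME a. a \<in> w p ` {0<..})"

lemma level_speed_pos: "level_speed w p > 0"
proof -
  have "w p 1 \<in> w p ` {0<..}" by simp
  then have "(SOME a. a \<in> w p ` {0<..}) \<in> w p ` {0<..}" by (rule someI)
  then have "level_speed w p \<in> {0<..}" unfolding level_speed_def by (rule inv_into_into)
  then show ?thesis by simp
qed

text \<open>Scaling by \<open>k\<close> permutes the positive speeds, so both ranges are the same
  set and \<open>SOME\<close> selects the same value from them. Injectivity of \<open>w q\<close>
  then makes the scaled speed the only preimage.\<close>

lemma level_speed_transport: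
  assumes inj: "inj_on (w q) {0<..}" and k: "k > 0"
    and tr: "\<And>t. t > 0 \<Longrightarrow> w q (t * k) = w p t"
  shows "level_speed w q = level_speed w p * k"
proof -
  have "w p ` {0<..} = w q ` {0<..}"
  proof (intro equalityI subsetI)
    fix a assume "a \<in> w p ` {0<..}"
    then obtain t where "t > 0" "a = w p t" by auto
    then show "a \<in> w q ` {0<..}" using tr[of t] k by (auto intro!: image_eqI[of _ _ "t * k"])
  next
    fix a assume "a \<in> w q ` {0<..}"
    then obtain t where "t > 0" "a = w q t" by auto
    then show "a \<in> w p ` {0<..}" using tr[of "t / k"] k by (auto intro!: image_eqI[of _ _ "t / k"])
  qed
  moreover have "(SOME a. a \<in> w p ` {0<..}) \<in> w p ` {0<..}"
    by (rule someI[of _ "w p 1"]) simp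
  then have "w p (level_speed w p) = (SOME a. a \<in> w p ` {0<..})"
    unfolding level_speed_def by (rule f_inv_into_f)
  ultimately have "w q (level_speed w p * k) = (SOME a. a \<in> w q ` {0<..})"
    using tr[OF level_speed_pos[of w p]] by metis
  then show ?thesis
    unfolding level_speed_def[of w q]
    by (intro inv_into_f_eq[OF inj]) (use k level_speed_pos[of w p] in auto)
qed

context riemannian_chart
begin

text \<open>The profile is constant along \<open>t exp (\<phi> s)\<close> where \<open>\<phi>\<close> integrates the covector \<open>- \<beta>\<close>.\<close>

lemma log_level_speed_along_segment:
  assumes w: "smooth_on (U \<times> {0<..}) (profile w)"
    and w': "\<And>x t. x \<in> U \<Longrightarrow> t > 0 \<Longrightarrow> d_speed (profile w) (x, t) \<noteq> 0"
    and \<beta>: "continuous_on U \<beta>" "\<And>x t. x \<in> U \<Longrightarrow> t > 0 \<Longrightarrow> slope w (x, t) = t *\<^sub>R \<beta> x"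
    and seg: "\<And>s. s \<in> {0..1} \<Longrightarrow> x + s *\<^sub>R u \<in> U"
  obtains \<theta> where "\<theta> \<in> {0..1}"
    "ln (level_speed w (pt c (x + u))) - ln (level_speed w (pt c x)) = - (\<beta> (x + \<theta> *\<^sub>R u) \<bullet> u)"
proof -
  let ?p = "\<lambda>s. x + s *\<^sub>R u"
  have "continuous_on {0..1} (\<lambda>s. - (\<beta> (?p s) \<bullet> u))"
    by (intro continuous_intros continuous_on_compose2[OF \<beta>(1)]) (use seg in auto)
  then obtain \<psi> where \<psi>: "\<And>s. s \<in> {0..1} \<Longrightarrow>
      (\<psi> has_vector_derivative - (\<beta> (?p s) \<bullet> u)) (at s within {0..1})"
    using antiderivative_continuous by blast
  \<comment> \<open>Normalised to vanish at 0, so that the transported curve starts at speed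
    \<open>t\<close>.\<close>
  define \<phi> where "\<phi> = (\<lambda>s. \<psi> s - \<psi> 0)"
  have \<phi>': "(\<phi> has_real_derivative - (\<beta> (?p s) \<bullet> u)) (at s within {0..1})" if "s \<in> {0..1}" for s
    using \<psi>[OF that] unfolding \<phi>_def has_real_derivative_iff_has_vector_derivative[symmetric]
    by (auto intro!: derivative_eq_intros)
  have level: "w (pt c (?p 1)) (t * exp (\<phi> 1)) = w (pt c x) t" if t: "t > 0" for t
  proof -
    let ?h = "\<lambda>s. profile w (?p s, t * exp (\<phi> s))"
    \<comment> \<open>Moving the base point changes the profile by slope times speed derivative; the
      logarithmic decay rate \<open>\<beta> \<bullet> u\<close> of the speed compensates this
      exactly.\<close>
    have "(?h has_derivative (\<lambda>r. 0)) (at s within {0..1})" if s: "s \<in> {0..1}" for s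
    proof -
      let ?z = "(?p s, t * exp (\<phi> s))"
      let ?D = "frechet_derivative (profile w) (at ?z)"
      have z: "?z \<in> U \<times> {0<..}" using seg[OF s] t by simp
      have diff: "profile w differentiable (at ?z)" by (rule smooth_on_differentiable[OF w z])
      have "((\<lambda>s. (?p s, t * exp (\<phi> s))) has_derivative
          (\<lambda>r. (r *\<^sub>R u, r * (- (\<beta> (?p s) \<bullet> u) * (t * exp (\<phi> s)))))) (at s within {0..1})"
        using \<phi>'[OF s, unfolded has_field_derivative_def]
        by (intro has_derivative_Pair) (auto intro!: derivative_eq_intros simp: mult_ac)
      from has_derivative_in_compose[OF this has_derivative_at_withinI[OF diff[unfolded frechet_derivative_works]]]
      have "(?h has_derivative
          (\<lambda>r. ?D (r *\<^sub>R u, r * (- (\<beta> (?p s) \<bullet> u) * (t * exp (\<phi> s)))))) (at s within {0..1})" .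
      moreover have "?D (r *\<^sub>R u, r * (- (\<beta> (?p s) \<bullet> u) * (t * exp (\<phi> s)))) = 0" for r
      proof -
        have ds: "d_space q (profile w) ?z = t * exp (\<phi> s) * \<beta> (?p s) $ q * d_speed (profile w) ?z" for q
        proof -
          have "slope w ?z $ q = t * exp (\<phi> s) * \<beta> (?p s) $ q"
            using \<beta>(2)[OF seg[OF s], of "t * exp (\<phi> s)"] t by simp
          then show ?thesis using w'[OF seg[OF s], of "t * exp (\<phi> s)"] t by (simp add: field_simps)
        qed
        have "?D (r *\<^sub>R u, 0) = (\<Sum>q\<in>UNIV. (r *\<^sub>R u) $ q * d_space q (profile w) ?z)"
          by (rule frechet_derivative_space_sum[OF diff])
        also have "\<dots> = r * (\<beta> (?p s) \<bullet> u) * (t * exp (\<phi> s)) * d_speed (profile w) ?z"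
          unfolding ds by (simp add: inner_vec_def sum_distrib_left sum_distrib_right mult_ac)
        finally have "?D (r *\<^sub>R u, 0) = r * (\<beta> (?p s) \<bullet> u) * (t * exp (\<phi> s)) * d_speed (profile w) ?z" .
        then show ?thesis
          by (subst frechet_derivative_pair_split[OF diff]) simp
      qed
      ultimately show ?thesis by simp
    qed
    then obtain a where "\<And>s. s \<in> {0..1} \<Longrightarrow> ?h s = a"
      using has_derivative_zero_constant[of "{0..1}" ?h] by auto
    from this[of 0] this[of 1] show ?thesis by (simp add: \<phi>_def)
  qed
  have "x + u \<in> U" using seg[of 1] by simp
  then have "inj_on (w (pt c (x + u))) {0<..}"
    using inj_on_pos_if_deriv_nonzero[of "\<lambda>t. profile w (x + u, t)" "\<lambda>t. d_speed (profile w) (x + u, t)"]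
      smooth_on_speed_section[OF w] w' by simp
  then have "level_speed w (pt c (x + u)) = level_speed w (pt c x) * exp (\<phi> 1)"
    by (rule level_speed_transport) (use level in auto)
  then have 1: "ln (level_speed w (pt c (x + u))) - ln (level_speed w (pt c x)) = \<phi> 1 - \<phi> 0"
    using level_speed_pos[of w "pt c x"] by (simp add: ln_mult \<phi>_def)
  \<comment> \<open>The increment of \<open>\<phi>\<close> is an integral of \<open>\<beta>\<close>
    over the segment; the mean value theorem replaces it by one value.\<close>
  obtain \<theta> where "\<theta> \<in> {0<..<1}" "\<phi> 1 - \<phi> 0 = - (\<beta> (?p \<theta>) \<bullet> u) * (1 - 0)"
    using mvt_simple[of 0 1 \<phi> "\<lambda>s. (*) (- (\<beta> (?p s) \<bullet> u))"] \<phi>'[unfolded has_field_derivative_def]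
    by auto
  then show thesis using that[of \<theta>] 1 by auto
qed

text \<open>On each short segment from \<open>x\<close> the increment is given by
  \<open>\<beta>\<close> at an intermediate point. Continuity of \<open>\<beta>\<close> and
  Cauchy-Schwarz make the error small relative to the length, so straight segments suffice for the
  total derivative.\<close>

lemma log_level_speed_has_derivative:
  assumes w: "smooth_on (U \<times> {0<..}) (profile w)"
    and w': "\<And>x t. x \<in> U \<Longrightarrow> t > 0 \<Longrightarrow> d_speed (profile w) (x, t) \<noteq> 0"
    and \<beta>: "continuous_on U \<beta>" "\<And>x t. x \<in> U \<Longrightarrow> t > 0 \<Longrightarrow> slope w (x, t) = t *\<^sub>R \<beta> x"
    and x: "x \<in> U"
  shows "((\<lambda>x. ln (level_speed w (pt c x))) has_derivative (\<lambda>u. - (\<beta> x \<bullet> u))) (at x)"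
  unfolding has_derivative_at_alt
proof (intro conjI allI impI)
  show "bounded_linear (\<lambda>u. - (\<beta> x \<bullet> u))"
    by (intro bounded_linear_minus bounded_linear_inner_right)
  fix e :: real
  assume "e > 0"
  obtain r where r: "r > 0" "ball x r \<subseteq> U" using open_U x open_contains_ball by blast
  have "isCont \<beta> x" using \<beta>(1) x continuous_on_eq_continuous_at[OF open_U] by blast
  then obtain d where d: "d > 0" "\<And>y. dist y x < d \<Longrightarrow> dist (\<beta> y) (\<beta> x) < e"
    using \<open>e > 0\<close> unfolding continuous_at_eps_delta by blast
  have "norm (ln (level_speed w (pt c y)) - ln (level_speed w (pt c x)) - - (\<beta> x \<bullet> (y - x)))
      \<le> e * norm (y - x)" if y: "norm (y - x) < min r d" for y
  proof -
    let ?u = "y - x"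
    have near: "dist (x + s *\<^sub>R ?u) x < min r d" if "s \<in> {0..1}" for s
    proof -
      have "\<bar>s\<bar> * norm ?u \<le> 1 * norm ?u" using that by (intro mult_right_mono) auto
      then show ?thesis using y by (simp add: dist_norm)
    qed
    have "x + s *\<^sub>R ?u \<in> U" if "s \<in> {0..1}" for s
      using near[OF that] r(2) by (auto simp: dist_commute)
    from log_level_speed_along_segment[OF w w' \<beta> this] obtain \<theta> where \<theta>: "\<theta> \<in> {0..1}"
      "ln (level_speed w (pt c (x + ?u))) - ln (level_speed w (pt c x)) = - (\<beta> (x + \<theta> *\<^sub>R ?u) \<bullet> ?u)"
      by blast
    then have "ln (level_speed w (pt c y)) - ln (level_speed w (pt c x)) - - (\<beta> x \<bullet> ?u) =
        - ((\<beta> (x + \<theta> *\<^sub>R ?u) - \<beta> x) \<bullet> ?u)"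
      by (simp add: inner_diff_left)
    also have "norm \<dots> \<le> norm (\<beta> (x + \<theta> *\<^sub>R ?u) - \<beta> x) * norm ?u"
      using Cauchy_Schwarz_ineq2 by simp
    also have "\<dots> \<le> e * norm ?u"
      using d(2)[of "x + \<theta> *\<^sub>R ?u"] near[OF \<theta>(1)] by (intro mult_right_mono) (auto simp: dist_norm)
    finally show ?thesis .
  qed
  then show "\<exists>d>0. \<forall>y. norm (y - x) < d \<longrightarrow>
      norm (ln (level_speed w (pt c y)) - ln (level_speed w (pt c x)) - - (\<beta> x \<bullet> (y - x))) \<le> e * norm (y - x)"
    using r(1) d(1) by (intro exI[of _ "min r d"]) simp
qed

lemma log_level_speed_chart:
  assumes "CARD('n) \<ge> 2"
    and w: "smooth_on (U \<times> {0<..}) (profile w)" and l: "smooth_on (U \<times> {0<..}) (profile l)"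
    and w': "\<And>x t. x \<in> U \<Longrightarrow> t > 0 \<Longrightarrow> d_speed (profile w) (x, t) \<noteq> 0"
    and F: "has_covariant_components A g F (W_force A g w)"
    and L: "has_lagrangian A g F (spherical g l)"
  defines "f \<equiv> \<lambda>p. ln (level_speed w p)"
  shows "smooth_on U (\<lambda>x. f (pt c x))"
    and "x \<in> U \<Longrightarrow> y \<noteq> 0 \<Longrightarrow> W_force A g w c r x y = f_force A g f c r x y"
proof -
  define \<beta> where "\<beta> = (\<lambda>x. slope w (x, 1))"
  have one: "smooth_on U (\<lambda>x. (x, 1::real))"
    by (intro smooth_on_Pair smooth_on_const open_U smooth_on_linear bounded_linear_ident)
  have comp: "smooth_on U (\<lambda>x. d_space q (profile w) (x, 1) / d_speed (profile w) (x, 1))" for q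
  proof -
    have "smooth_on (U \<times> {0<..}) (\<lambda>z. d_space q (profile w) z / d_speed (profile w) z)"
      using w' by (intro smooth_on_divide smooth_on_frechet_derivative w open_dom) auto
    from smooth_on_comp[OF open_U open_dom(2) _ this one] show ?thesis by fastforce
  qed
  have "\<beta> = (\<lambda>x. \<Sum>q\<in>UNIV. (d_space q (profile w) (x, 1) / d_speed (profile w) (x, 1)) *\<^sub>R axis q 1)"
    unfolding \<beta>_def by (subst vec_basis_sum) simp
  then have \<beta>s: "smooth_on U \<beta>"
    by (simp only:) (intro smooth_on_sum smooth_on_scaleR smooth_on_const comp open_U finite)
  have \<beta>: "slope w (x, t) = t *\<^sub>R \<beta> x" if "x \<in> U" "t > 0" for x t
    unfolding \<beta>_def by (rule slope_linear[OF assms(1) w l w' F L that])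
  have f': "((\<lambda>x. f (pt c x)) has_derivative (\<lambda>u. - (\<beta> x \<bullet> u))) (at x)" if "x \<in> U" for x
    unfolding f_def by (rule log_level_speed_has_derivative[OF w w' smooth_on_continuous[OF \<beta>s] \<beta> that])
  \<comment> \<open>\<open>level_speed\<close> rests on arbitrary choices; smoothness is inherited
    from the derivative, given by the smooth covector \<open>- \<beta>\<close>.\<close>
  show "smooth_on U (\<lambda>x. f (pt c x))"
    by (rule smooth_onI_derivative[OF open_U f'], assumption)
       (intro smooth_on_linear_comp[OF open_U _ \<beta>s] bounded_linear_minus bounded_linear_inner_left)
  show "W_force A g w c r x y = f_force A g f c r x y" if "x \<in> U" "y \<noteq> 0"
  proof -
    have "(\<chi> q. partial q (\<lambda>x. f (pt c x)) x) = - \<beta> x"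
      by (simp add: vec_eq_iff partial_eq[OF f'[OF that(1)]] inner_axis)
    then show ?thesis
      unfolding W_force_loc[OF w that] f_force_loc[OF that(1)] \<beta>[OF that(1) \<nu>_pos[OF that]]
      using \<nu>_pos[OF that] by (simp add: power2_eq_square)
  qed
qed


section \<open>Lagrangians and homogeneous profiles from a potential\<close>

lemma potential_has_derivative:
  assumes "smooth_function A f" "x \<in> U"
  shows "((\<lambda>x. f (pt c x)) has_derivative frechet_derivative (\<lambda>x. f (pt c x)) (at x)) (at x)"
  using assms chart by (auto simp: smooth_function_def intro: smooth_on_has_derivative)

lemma smooth_potential_fst:
  assumes "smooth_function A f"
  shows "smooth_on (U \<times> {0::real<..}) (\<lambda>z. f (pt c (fst z)))"
  by (rule smooth_on_comp[OF open_dom(2) open_U])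
     (use assms chart open_dom in \<open>auto simp: smooth_function_def intro: smooth_on_linear bounded_linear_fst\<close>)

text \<open>The slope of \<open>v exp (-f)\<close> is \<open>-t\<close> times the gradient of
  \<open>f\<close>, precisely the slope that turns one force formula into the other.\<close>

lemma
  assumes f: "smooth_function A f"
  defines "w \<equiv> \<lambda>p v. v * exp (- f p)"
  shows exp_profile_smooth: "smooth_on (U \<times> {0<..}) (profile w)"
    and W_force_exp_profile: "x \<in> U \<Longrightarrow> y \<noteq> 0 \<Longrightarrow> W_force A g w c r x y = f_force A g f c r x y"
proof -
  show w: "smooth_on (U \<times> {0<..}) (profile w)"
    unfolding w_def
    by (intro smooth_on_mult smooth_on_exp smooth_on_linear_comp[OF _ bounded_linear_minus[OF bounded_linear_ident]]
        smooth_potential_fst f smooth_on_linear bounded_linear_snd open_dom)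
  assume x: "x \<in> U" and y: "y \<noteq> 0"
  let ?Df = "frechet_derivative (\<lambda>x. f (pt c x)) (at x)"
  let ?t = "\<nu> x y"
  have fst: "((\<lambda>z. f (pt c (fst z))) has_derivative (\<lambda>z. ?Df (fst z))) (at (x, ?t))"
    by (rule has_derivative_compose[OF bounded_linear_imp_has_derivative[OF bounded_linear_fst]])
       (simp add: potential_has_derivative[OF f x])
  have "(profile w has_derivative (\<lambda>u. snd u * exp (- f (pt c x)) - ?t * exp (- f (pt c x)) * ?Df (fst u))) (at (x, ?t))"
    unfolding w_def
    by (rule derivative_eq_intros fst refl bounded_linear_imp_has_derivative[OF bounded_linear_snd])+
       (simp add: algebra_simps)
  note D = frechet_derivative_at[OF this, symmetric]
  have lin: "linear ?Df" by (rule has_derivative_linear[OF potential_has_derivative[OF f x]])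
  have "slope w (x, ?t) = - ?t *\<^sub>R (\<chi> q. partial q (\<lambda>x. f (pt c x)) x)"
    by (simp add: D vec_eq_iff linear_0[OF lin] partial_eq[OF potential_has_derivative[OF f x]])
  then show "W_force A g w c r x y = f_force A g f c r x y"
    unfolding W_force_loc[OF w x y] f_force_loc[OF x]
    using \<nu>_pos[OF x y] by (simp add: power2_eq_square)
qed

text \<open>The momentum is \<open>exp (-2 f)\<close>, independent of the speed, so the Hessian is a
  positive multiple of the metric.\<close>

lemma
  assumes f: "smooth_function A f"
  defines "l \<equiv> \<lambda>p v. v * v * exp (- 2 * f p) / 2"
  shows kinetic_profile_smooth: "smooth_on (U \<times> {0<..}) (profile l)"
    and kinetic_hessian: "x \<in> U \<Longrightarrow> y \<noteq> 0 \<Longrightarrow>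
      det ((\<chi> i j. vgrad i (vgrad j (loc A c (spherical g l))) x y) :: real ^ 'n ^ 'n) \<noteq> 0"
    and kinetic_euler_lagrange: "x \<in> U \<Longrightarrow> y \<noteq> 0 \<Longrightarrow> (\<And>r. lower A g c x \<phi> r = f_force A g f c r x y) \<Longrightarrow>
      (\<Sum>s\<in>UNIV. vgrad s (vgrad k (loc A c (spherical g l))) x y * \<phi> $ s)
      + (\<Sum>s\<in>UNIV. sgrad_covec A g c s (\<lambda>k. vgrad k (loc A c (spherical g l))) k x y * y $ s)
      - sgrad A g c k (loc A c (spherical g l)) x y = 0"
proof -
  show l: "smooth_on (U \<times> {0<..}) (profile l)"
    unfolding l_def divide_inverse
    by (intro smooth_on_mult smooth_on_exp smooth_on_const
        smooth_potential_fst f smooth_on_linear bounded_linear_snd open_dom)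
  let ?E = "\<lambda>x. exp (- 2 * f (pt c x))"
  let ?Df = "\<lambda>x. frechet_derivative (\<lambda>x. f (pt c x)) (at x)"
  have fst: "((\<lambda>z. f (pt c (fst z))) has_derivative (\<lambda>z. ?Df x (fst z))) (at (x, t))" if "x \<in> U" for x and t :: real
    by (rule has_derivative_compose[OF bounded_linear_imp_has_derivative[OF bounded_linear_fst]])
       (simp add: potential_has_derivative[OF f that])
  have E: "((\<lambda>z. ?E (fst z)) has_derivative (\<lambda>u. - 2 * ?E x * ?Df x (fst u))) (at (x, t))"
    if "x \<in> U" for x and t :: real
    by (rule derivative_eq_intros fst[OF that] refl)+ (simp add: algebra_simps)
  have "(profile l has_derivative (\<lambda>u. t * snd u * ?E x - t * t * ?E x * ?Df x (fst u))) (at (x, t))"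
    if "x \<in> U" for x t
    unfolding l_def
    by (rule derivative_eq_intros fst[OF that] refl bounded_linear_imp_has_derivative[OF bounded_linear_snd] | simp)+
       (simp add: algebra_simps diff_divide_distrib)
  note D = frechet_derivative_at[OF this, symmetric]
  have lin: "linear (?Df x)" if "x \<in> U" for x
    by (rule has_derivative_linear[OF potential_has_derivative[OF f that]])
  have m: "momentum l z = ?E (fst z)" if "z \<in> U \<times> {0<..}" for z
    using that by (cases z) (auto simp: D linear_0[OF lin])
  \<comment> \<open>The quotient \<open>momentum l\<close> is known to equal
    \<open>exp (-2 f)\<close> only at positive speeds; openness of that domain transfers the
    derivative.\<close>
  have Dm: "frechet_derivative (momentum l) (at (x, t)) = (\<lambda>u. - 2 * ?E x * ?Df x (fst u))"
    if "x \<in> U" "t > 0" for x t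
    using frechet_derivative_at[OF E[OF that(1)]]
      frechet_derivative_transform_within_open[OF open_dom(2) _ m, of "(x, t)"] that by auto
  assume x: "x \<in> U" and y: "y \<noteq> 0"
  note pos = \<nu>_pos[OF x y]
  have mx: "momentum l (x, \<nu> x y) = ?E x" using m[of "(x, \<nu> x y)"] x pos by simp
  have dm: "d_speed (momentum l) (x, \<nu> x y) = 0"
    unfolding Dm[OF x pos] by (simp add: linear_0[OF lin[OF x]])
  define d where "d = (\<chi> q. partial q (\<lambda>x. f (pt c x)) x)"
  have d: "?Df x (axis q 1) = d $ q" for q
    by (simp add: d_def partial_eq[OF potential_has_derivative[OF f x]])
  show "det ((\<chi> i j. vgrad i (vgrad j (loc A c (spherical g l))) x y) :: real ^ 'n ^ 'n) \<noteq> 0"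
    unfolding det_nz_iff_ker
  proof (intro allI impI)
    fix z :: "real ^ 'n"
    assume "(\<chi> i j. vgrad i (vgrad j (loc A c (spherical g l))) x y) *v z = 0"
    moreover have "(\<chi> i j. vgrad i (vgrad j (loc A c (spherical g l))) x y) = ?E x *\<^sub>R G x"
      unfolding hessian_loc[OF l x y] mx dm using G_sym[OF x] by (simp add: vec_eq_iff)
    ultimately have "G x *v z = 0"
      by (simp add: scaleR_matrix_vector_assoc[symmetric])
    then show "z = 0" using G_pos[OF x, of z] by fastforce
  qed
  assume "\<And>r. lower A g c x \<phi> r = f_force A g f c r x y"
  then have 1: "(G x *v \<phi>) $ k = 2 * (d \<bullet> y) * (G x *v y) $ k - (\<nu> x y)\<^sup>2 * d $ k"
    unfolding lower_eq f_force_loc[OF x] d_def .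
  have 2: "(\<Sum>s\<in>UNIV. d_space s (momentum l) (x, \<nu> x y) * y $ s) = - 2 * ?E x * (d \<bullet> y)"
    unfolding Dm[OF x pos] fst_conv d inner_vec_def inner_real_def sum_distrib_left
    by (intro sum.cong refl) simp
  have 3: "d_space k (profile l) (x, \<nu> x y) = - (\<nu> x y)\<^sup>2 * ?E x * d $ k"
    unfolding D[OF x] by (simp add: d power2_eq_square)
  show "(\<Sum>s\<in>UNIV. vgrad s (vgrad k (loc A c (spherical g l))) x y * \<phi> $ s)
      + (\<Sum>s\<in>UNIV. sgrad_covec A g c s (\<lambda>k. vgrad k (loc A c (spherical g l))) k x y * y $ s)
      - sgrad A g c k (loc A c (spherical g l)) x y = 0"
    \<comment> \<open>The speed derivative of the momentum is gone. The change of momentum cancels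
      the part of the force along the lowered velocity, and the gradient of \<open>l\<close> cancels
      the part along \<open>d\<close>.\<close>
    unfolding euler_lagrange_loc[OF l x y] mx dm 1 2 3 by (simp add: algebra_simps)
qed

end

theorem theorem8p1:
  fixes T :: "'m topology"
    and A :: "('m, 'n::finite) chart set"
    and g :: "('m, 'n) metric"
    and w :: "'m \<Rightarrow> real \<Rightarrow> real"
    and F :: "('m, 'n) ext_vector"
  assumes "smooth_manifold T A"
    and "CARD('n) \<ge> 2"
    and "riemannian_metric A g"
    and "extended_scalar_field A (spherical g w)"
    and "\<forall>p\<in>topspace T. \<forall>r>0. deriv (w p) r \<noteq> 0"
    and "extended_vector_field A F"
    and "has_covariant_components A g F (W_force A g w)"
  shows "((\<exists>l. extended_scalar_field A (spherical g l) \<and> has_lagrangian A g F (spherical g l)) \<longleftrightarrow>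
          (\<exists>f. smooth_function A f \<and> has_covariant_components A g F (f_force A g f))) \<and>
         (\<forall>f. smooth_function A f \<longrightarrow>
            (let w\<^sub>f = (\<lambda>p v. v * exp (- f p)) in
              extended_scalar_field A (spherical g w\<^sub>f) \<and>
              (\<forall>p\<in>topspace T. \<forall>r>0. deriv (w\<^sub>f p) r \<noteq> 0) \<and>
              (\<forall>c\<in>A. \<forall>x\<in>cimg c. \<forall>y. y \<noteq> 0 \<longrightarrow>
                 (\<forall>r. W_force A g w\<^sub>f c r x y = f_force A g f c r x y))))"
proof (intro conjI iffI allI impI)
  have chart: "riemannian_chart T A g c" if "c \<in> A" for c
    using assms(1,3) that by (simp add: riemannian_chart_def)
  {
    assume "\<exists>l. extended_scalar_field A (spherical g l) \<and> has_lagrangian A g F (spherical g l)"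
    then obtain l where l: "extended_scalar_field A (spherical g l)" "has_lagrangian A g F (spherical g l)"
      by blast
    \<comment> \<open>No chart occurs in this definition, so nothing has to be glued: each chart
      only confirms smoothness and the force formula for the same \<open>f\<close>.\<close>
    define f where "f = (\<lambda>p. ln (level_speed w p))"
    have *: "smooth_on (cimg c) (\<lambda>x. f (pt c x)) \<and> (\<forall>x\<in>cimg c. \<forall>y. y \<noteq> 0 \<longrightarrow>
        (\<forall>r. W_force A g w c r x y = f_force A g f c r x y))" if c: "c \<in> A" for c
    proof -
      interpret riemannian_chart T A g c by (rule chart[OF c])
      note w = profile_smooth[OF assms(4)]
      have "pt c x \<in> topspace T" if "x \<in> cimg c" for x
        using pt_in[OF that] assms(1) c by (auto simp: smooth_manifold_def)
      then have "d_speed (profile w) (x, t) \<noteq> 0" if "x \<in> cimg c" "t > 0" for x t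
        using assms(5) deriv_profile[OF w that] that by metis
      from log_level_speed_chart[OF assms(2) w profile_smooth[OF l(1)] this assms(7) l(2)]
      show ?thesis unfolding f_def by blast
    qed
    then have "smooth_function A f" by (simp add: smooth_function_def)
    moreover have "has_covariant_components A g F (f_force A g f)"
      using assms(7) * by (simp add: has_covariant_components_def)
    ultimately show "\<exists>f. smooth_function A f \<and> has_covariant_components A g F (f_force A g f)" by blast
  next
    assume "\<exists>f. smooth_function A f \<and> has_covariant_components A g F (f_force A g f)"
    then obtain f where f: "smooth_function A f" "has_covariant_components A g F (f_force A g f)" by blast
    define l where "l = (\<lambda>p v. v * v * exp (- 2 * f p) / 2)"
    have "extended_scalar_field A (spherical g l)"
      unfolding extended_scalar_field_def
    proof
      fix c assume "c \<in> A"
      then interpret riemannian_chart T A g c by (rule chart)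
      show "smooth_on (cimg c \<times> (UNIV - {0})) (\<lambda>(x, y). loc A c (spherical g l) x y)"
        unfolding l_def by (rule spherical_smooth[OF kinetic_profile_smooth[OF f(1)]])
    qed
    moreover have "has_lagrangian A g F (spherical g l)"
      unfolding has_lagrangian_def Let_def
    proof (intro ballI allI impI conjI)
      fix c x and y :: "real ^ 'n" assume c: "c \<in> A" and x: "x \<in> cimg c" and y: "y \<noteq> 0"
      interpret riemannian_chart T A g c by (rule chart[OF c])
      show "det ((\<chi> i j. vgrad i (vgrad j (loc A c (spherical g l))) x y) :: real ^ 'n ^ 'n) \<noteq> 0"
        unfolding l_def by (rule kinetic_hessian[OF f(1) x y])
      have "lower A g c x (loc_vec A c F x y) r = f_force A g f c r x y" for r
        using f(2) c x y unfolding has_covariant_components_def by blast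
      from kinetic_euler_lagrange[OF f(1) x y this]
      show "(\<Sum>s\<in>UNIV. vgrad s (vgrad k (loc A c (spherical g l))) x y * loc_vec A c F x y $ s)
          + (\<Sum>s\<in>UNIV. sgrad_covec A g c s (\<lambda>k. vgrad k (loc A c (spherical g l))) k x y * y $ s)
          - sgrad A g c k (loc A c (spherical g l)) x y = 0" for k
        unfolding l_def .
    qed
    ultimately show "\<exists>l. extended_scalar_field A (spherical g l) \<and> has_lagrangian A g F (spherical g l)"
      by blast
  next
    fix f :: "'m \<Rightarrow> real"
    assume f: "smooth_function A f"
    let ?w = "\<lambda>p v. v * exp (- f p)"
    have "smooth_on (cimg c \<times> (UNIV - {0})) (\<lambda>(x, y). loc A c (spherical g ?w) x y) \<and>
        (\<forall>x\<in>cimg c. \<forall>y. y \<noteq> 0 \<longrightarrow> (\<forall>r. W_force A g ?w c r x y = f_force A g f c r x y))"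
      if c: "c \<in> A" for c
    proof -
      interpret riemannian_chart T A g c by (rule chart[OF c])
      show ?thesis
        using spherical_smooth[OF exp_profile_smooth[OF f]] W_force_exp_profile[OF f] by blast
    qed
    moreover have "deriv (?w p) r \<noteq> 0" for p r
    proof -
      have "(?w p has_real_derivative exp (- f p)) (at r)"
        by (auto intro!: derivative_eq_intros)
      then show ?thesis by (simp add: DERIV_imp_deriv)
    qed
    ultimately show "let w\<^sub>f = (\<lambda>p v. v * exp (- f p)) in
        extended_scalar_field A (spherical g w\<^sub>f) \<and>
        (\<forall>p\<in>topspace T. \<forall>r>0. deriv (w\<^sub>f p) r \<noteq> 0) \<and>
        (\<forall>c\<in>A. \<forall>x\<in>cimg c. \<forall>y. y \<noteq> 0 \<longrightarrow>
           (\<forall>r. W_force A g w\<^sub>f c r x y = f_force A g f c r x y))"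
      unfolding Let_def extended_scalar_field_def by blast
  }
qed

end
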